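(* Let $(W,S,* )$ be a twisted Coxeter system. For every $w\in\mathcal{I}_*$, the set $\hat{\mathcal{R}}_*(1,w)$ is an equivalence class of finite words in $S$ under $\sim_{\mathcal{I}_*}$.
   Context: A twisted Coxeter system $(W,S,\star)$ is a Coxeter system $(W,S)$ with length $\ell$ and an automorphism $\star$ of $W$ with $S^\star=S$, $\star^2=\mathrm{id}$; $\mathcal{I}_\star=\{w:w^{-1}=w^\star\}$. The Demazure product $\circ$ is the unique associative operation on $W$ with $s\circ w = sw$ if $\ell(sw)>\ell(w)$ and $s\circ w=w$ otherwise, and $w\circ s=ws$ if $\ell(ws)>\ell(w)$ and $w\circ s = w$ otherwise, for $s\in S$; put $x\ltimes_\star w=(w^\star)^{-1}\circ x\circ w$. $\hat{\mathcal{R}}_\star(x,y)$ is the set of words $(s_1,\dots,s_k)$ in $S$ of shortest length with $(\cdots(x\ltimes_\star s_1)\cdots)\ltimes_\star s_k=y$, and $\hat\ell_\star(y)$ is the length of words in $\hat{\mathcal{R}}_\star(1,y)$. Let $m(s,t)$ be the order of $st$. For a word $\mathbf{a}=(a_1,\dots,a_j)$ let $u=\hat\delta_*(\mathbf{a})=(\cdots(1\ltimes_* a_1)\cdots)\ltimes_* a_j$ and $\theta_{\mathbf{a}}(g)=(ugu^{-1})^*$. For $s,t\in S$ with $m(s,t)<\infty$ let $\Delta$ be the longest element of $W_{\{s,t\}}=\langle s,t\rangle$; define $m(s,t;\theta_{\mathbf{a}})=\hat\ell_\theta(\Delta)$ computed in the twisted Coxeter system $(W_{\{s,t\}},\{s,t\},\theta)$,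 where $\theta$ is the diagram automorphism extending the permutation $\theta_{\mathbf{a}}|_{\{s,t\}}$, if $\theta_{\mathbf{a}}(\{s,t\})=\{s,t\}$; and $m(s,t;\theta_{\mathbf{a}})=\ell(\Delta)$ otherwise. $\sim_{\mathcal{I}_*}$ is the transitive closure of the relation $(a_1,\dots,a_j,s,t,s,t,\dots,b_1,\dots,b_k)\sim_{\mathcal{I}_*}(a_1,\dots,a_j,t,s,t,s,\dots,b_1,\dots,b_k)$, where the alternating middle segments have $m=m(s,t;\theta_{\mathbf{a}})$ terms, $\mathbf{a}=(a_1,\dots,a_j)$, and $s,t,a_i,b_i\in S$ with $m(s,t)<\infty$. *)

theory Defs
  imports "HOL-Algebra.Algebra"
begin

section \<open>Coxeter systems\<close>

definition word_prod :: "('a, 'b) monoid_scheme \<Rightarrow> 'a list \<Rightarrow> 'a" where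
  "word_prod W ws = foldr (\<lambda>x y. x \<otimes>\<^bsub>W\<^esub> y) ws \<one>\<^bsub>W\<^esub>"

definition cox_m :: "('a, 'b) monoid_scheme \<Rightarrow> 'a \<Rightarrow> 'a \<Rightarrow> nat" where
  "cox_m W s t = group.ord W (s \<otimes>\<^bsub>W\<^esub> t)"  \<comment> \<open>the value 0 encodes infinite order\<close>

text \<open>The congruence on words in \<open>S\<close> generated by the relators \<open>(st)\<^sup>m = 1\<close>, \<open>m = m(s,t) < \<infinity>\<close>.
  As \<open>s = t\<close> is included and \<open>m(s,s) = 1\<close> for involutions, each generator is its own inverse in the
  quotient monoid, which is therefore the group presented by these generators and relations.\<close>

inductive cox_cong :: "('a, 'b) monoid_scheme \<Rightarrow> 'a set \<Rightarrow> 'a list \<Rightarrow> 'a list \<Rightarrow> bool"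
  for W :: "('a, 'b) monoid_scheme" and S :: "'a set" where
  refl: "x \<in> lists S \<Longrightarrow> cox_cong W S x x"
| sym: "cox_cong W S x y \<Longrightarrow> cox_cong W S y x"
| trans: "cox_cong W S x y \<Longrightarrow> cox_cong W S y z \<Longrightarrow> cox_cong W S x z"
| relator: "\<lbrakk>x \<in> lists S; y \<in> lists S; s \<in> S; t \<in> S; cox_m W s t \<noteq> 0\<rbrakk> \<Longrightarrow>
    cox_cong W S (x @ concat (replicate (cox_m W s t) [s, t]) @ y) (x @ y)"

text \<open>The last assumption says that the canonical surjection from the group presented by \<open>S\<close> and the
  relations \<open>(st)\<^bsup>m(s,t)\<^esup> = 1\<close> onto \<open>W\<close> has trivial kernel.\<close>

locale coxeter_system = group W for W :: "('a, 'b) monoid_scheme" (structure) +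
  fixes S :: "'a set"
  assumes S_carrier: "S \<subseteq> carrier W"
    and S_generates: "generate W S = carrier W"
    and S_order_2: "s \<in> S \<Longrightarrow> ord s = 2"
    and presentation: "\<lbrakk>x \<in> lists S; word_prod W x = \<one>\<rbrakk> \<Longrightarrow> cox_cong W S x []"

locale twisted_coxeter_system = coxeter_system W S
  for W :: "('a, 'b) monoid_scheme" (structure) and S :: "'a set" +
  fixes star :: "'a \<Rightarrow> 'a"
  assumes star_iso: "star \<in> iso W W"
    and star_S: "star ` S = S"
    and star_star: "w \<in> carrier W \<Longrightarrow> star (star w) = w"

definition cox_length :: "('a, 'b) monoid_scheme \<Rightarrow> 'a set \<Rightarrow> 'a \<Rightarrow> nat" where
  "cox_length W S w = (LEAST n. \<exists>x \<in> lists S. length x = n \<and> word_prod W x = w)"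

definition longest_element :: "('a, 'b) monoid_scheme \<Rightarrow> 'a set \<Rightarrow> 'a set \<Rightarrow> 'a" where
  "longest_element W S J =
    (THE d. d \<in> generate W J \<and> (\<forall>w \<in> generate W J. cox_length W S w \<le> cox_length W S d))"

section \<open>The Demazure product and twisted involutions\<close>

text \<open>The clause for the unit matters only in rank one: for \<open>S = {s}\<close> the operation that is constantly
  \<open>s\<close> is associative and satisfies the clauses for multiplication by \<open>s\<close>, too. In all other ranks the
  unit law follows from the remaining clauses. The values outside the carrier are fixed in order to
  make the operation unique as a HOL function.\<close>

definition is_demazure_product ::
  "('a, 'b) monoid_scheme \<Rightarrow> 'a set \<Rightarrow> ('a \<Rightarrow> 'a \<Rightarrow> 'a) \<Rightarrow> bool" where
  "is_demazure_product W S f \<longleftrightarrow>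
    (\<forall>x \<in> carrier W. \<forall>y \<in> carrier W. f x y \<in> carrier W) \<and>
    (\<forall>x y. x \<notin> carrier W \<or> y \<notin> carrier W \<longrightarrow> f x y = undefined) \<and>
    (\<forall>x \<in> carrier W. \<forall>y \<in> carrier W. \<forall>z \<in> carrier W. f (f x y) z = f x (f y z)) \<and>
    (\<forall>w \<in> carrier W. f \<one>\<^bsub>W\<^esub> w = w \<and> f w \<one>\<^bsub>W\<^esub> = w) \<and>
    (\<forall>s \<in> S. \<forall>w \<in> carrier W.
      f s w = (if cox_length W S (s \<otimes>\<^bsub>W\<^esub> w) > cox_length W S w then s \<otimes>\<^bsub>W\<^esub> w else w) \<and>
      f w s = (if cox_length W S (w \<otimes>\<^bsub>W\<^esub> s) > cox_length W S w then w \<otimes>\<^bsub>W\<^esub> s else w))"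

definition demazure :: "('a, 'b) monoid_scheme \<Rightarrow> 'a set \<Rightarrow> 'a \<Rightarrow> 'a \<Rightarrow> 'a" where
  "demazure W S = (THE f. is_demazure_product W S f)"

definition twisted_involutions :: "('a, 'b) monoid_scheme \<Rightarrow> ('a \<Rightarrow> 'a) \<Rightarrow> 'a set" where
  "twisted_involutions W star = {w \<in> carrier W. inv\<^bsub>W\<^esub> w = star w}"

definition twisted_conj ::
  "('a, 'b) monoid_scheme \<Rightarrow> 'a set \<Rightarrow> ('a \<Rightarrow> 'a) \<Rightarrow> 'a \<Rightarrow> 'a \<Rightarrow> 'a" where
  "twisted_conj W S star x w =
    demazure W S (demazure W S (inv\<^bsub>W\<^esub> (star w)) x) w"

text \<open>\<open>twisted_conj_word W S star x [s\<^sub>1, \<dots>, s\<^sub>k]\<close> is \<open>(\<dots>(x \<ltimes> s\<^sub>1)\<dots>) \<ltimes> s\<^sub>k\<close>; for \<open>x = 1\<close> it is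
  the map \<open>\<delta>\<close>-hat on words.\<close>

definition twisted_conj_word ::
  "('a, 'b) monoid_scheme \<Rightarrow> 'a set \<Rightarrow> ('a \<Rightarrow> 'a) \<Rightarrow> 'a \<Rightarrow> 'a list \<Rightarrow> 'a" where
  "twisted_conj_word W S star x ws = foldl (twisted_conj W S star) x ws"

definition involution_words ::
  "('a, 'b) monoid_scheme \<Rightarrow> 'a set \<Rightarrow> ('a \<Rightarrow> 'a) \<Rightarrow> 'a \<Rightarrow> 'a \<Rightarrow> 'a list set" where
  "involution_words W S star x y =
    {ws \<in> lists S. twisted_conj_word W S star x ws = y \<and>
      (\<forall>vs \<in> lists S. twisted_conj_word W S star x vs = y \<longrightarrow> length ws \<le> length vs)}"

definition involution_length ::
  "('a, 'b) monoid_scheme \<Rightarrow> 'a set \<Rightarrow> ('a \<Rightarrow> 'a) \<Rightarrow> 'a \<Rightarrow> nat" where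
  "involution_length W S star y = the_elem (length ` involution_words W S star \<one>\<^bsub>W\<^esub> y)"

section \<open>Braid relations for involution words\<close>

definition theta ::
  "('a, 'b) monoid_scheme \<Rightarrow> 'a set \<Rightarrow> ('a \<Rightarrow> 'a) \<Rightarrow> 'a list \<Rightarrow> 'a \<Rightarrow> 'a" where
  "theta W S star a g =
    (let u = twisted_conj_word W S star \<one>\<^bsub>W\<^esub> a in star (u \<otimes>\<^bsub>W\<^esub> g \<otimes>\<^bsub>W\<^esub> inv\<^bsub>W\<^esub> u))"

definition diagram_aut :: "('a, 'b) monoid_scheme \<Rightarrow> 'a set \<Rightarrow> ('a \<Rightarrow> 'a) \<Rightarrow> 'a \<Rightarrow> 'a" where
  "diagram_aut W J p =
    (THE f. f \<in> iso (subgroup_generated W J) (subgroup_generated W J) \<and>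
      f \<in> extensional (carrier (subgroup_generated W J)) \<and> (\<forall>j \<in> J. f j = p j))"

definition twisted_m ::
  "('a, 'b) monoid_scheme \<Rightarrow> 'a set \<Rightarrow> ('a \<Rightarrow> 'a) \<Rightarrow> 'a list \<Rightarrow> 'a \<Rightarrow> 'a \<Rightarrow> nat" where
  "twisted_m W S star a s t =
    (let J = {s, t}; \<Delta> = longest_element W S J; p = theta W S star a in
      if p ` J = J
      then involution_length (subgroup_generated W J) J (diagram_aut W J p) \<Delta>
      else cox_length W S \<Delta>)"

fun alternating :: "'a \<Rightarrow> 'a \<Rightarrow> nat \<Rightarrow> 'a list" where
  "alternating s t 0 = []"
| "alternating s t (Suc n) = s # alternating t s n"

definition braid_step ::
  "('a, 'b) monoid_scheme \<Rightarrow> 'a set \<Rightarrow> ('a \<Rightarrow> 'a) \<Rightarrow> ('a list \<times> 'a list) set" where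
  "braid_step W S star =
    {(a @ alternating s t m @ b, a @ alternating t s m @ b) | a b s t m.
      a \<in> lists S \<and> b \<in> lists S \<and> s \<in> S \<and> t \<in> S \<and> cox_m W s t \<noteq> 0 \<and>
      m = twisted_m W S star a s t}"

text \<open>Reflexivity has to be added only for the empty word: a step with \<open>s = t\<close> relates every nonempty
  word to itself.\<close>

definition involution_braid_rel ::
  "('a, 'b) monoid_scheme \<Rightarrow> 'a set \<Rightarrow> ('a \<Rightarrow> 'a) \<Rightarrow> ('a list \<times> 'a list) set" where
  "involution_braid_rel W S star = (braid_step W S star)\<^sup>* \<inter> (lists S \<times> lists S)"

lemma (in coxeter_system) cox_m_commute_0:
  assumes "s \<in> S" "t \<in> S"
  shows "cox_m W s t = 0 \<longleftrightarrow> cox_m W t s = 0"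
proof -
  have c: "s \<in> carrier W" "t \<in> carrier W" using assms S_carrier by auto
  have *: "inv r = r" if "r \<in> S" for r
  proof -
    have r: "r \<in> carrier W" using that S_carrier by auto
    have "r [^] (2::nat) = \<one>" using S_order_2[OF that] pow_ord_eq_1[OF r] by simp
    then have "r \<otimes> r = \<one>" using r by (simp add: numeral_2_eq_2)
    then show ?thesis using r by (intro inv_equality)
  qed
  have e: "inv (s \<otimes> t) = t \<otimes> s" using c * assms by (simp add: inv_mult_group)
  have "ord (inv (s \<otimes> t)) = ord (s \<otimes> t)" using c by (intro ord_inv) auto
  then show ?thesis unfolding cox_m_def e by simp
qed

lemma (in coxeter_system) equiv_involution_braid_rel:
  "equiv (lists S) (involution_braid_rel W S star)"
proof -
  have m: "twisted_m W S star a s t = twisted_m W S star a t s" for a s t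
    by (simp add: twisted_m_def insert_commute)
  have "sym (braid_step W S star)"
  proof (rule symI)
    fix x y assume "(x, y) \<in> braid_step W S star"
    then obtain a b s t where
      "x = a @ alternating s t (twisted_m W S star a s t) @ b"
      "y = a @ alternating t s (twisted_m W S star a s t) @ b"
      and *: "a \<in> lists S" "b \<in> lists S" "s \<in> S" "t \<in> S" "cox_m W s t \<noteq> 0"
      unfolding braid_step_def by blast
    then have "y = a @ alternating t s (twisted_m W S star a t s) @ b"
      "x = a @ alternating s t (twisted_m W S star a t s) @ b"
      by (simp_all only: m[of a s t])
    moreover have "cox_m W t s \<noteq> 0" using * cox_m_commute_0[of s t] by simp
    ultimately show "(y, x) \<in> braid_step W S star"
      unfolding braid_step_def using * by blast
  qed
  then have "sym ((braid_step W S star)\<^sup>*)" by (rule sym_rtrancl)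
  moreover have "trans ((braid_step W S star)\<^sup>*)" by (rule trans_rtrancl)
  ultimately show ?thesis
    unfolding involution_braid_rel_def
    by (intro equivI refl_onI symI transI) (blast dest: symD transD)+
qed

end

theory Submission
  imports Defs
begin

text \<open>
  Call a word ascending if every step strictly increases the length. A descending step leaves the
  element unchanged, so shortest words are ascending. As in the proof of Matsumoto's theorem,
  induction on the length of \<open>w\<close> reduces the comparison of two ascending words for \<open>w\<close>, ending in
  \<open>s \<noteq> t\<close>, to the double coset of the dihedral group \<open>W\<^sub>J\<close>, \<open>J = {s, t}\<close>: below \<open>w\<close> there is a
  twisted involution \<open>u\<close> without descents in \<open>J\<close>, and both alternating words in \<open>J\<close> lead from \<open>u\<close>
  up to \<open>w\<close>. If \<open>\<theta>(J) = J\<close>, then \<open>u \<ltimes> x = u \<cdot> (1 \<ltimes>\<^sub>\<theta> x)\<close> for words \<open>x\<close> in \<open>J\<close>, and the number of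
  steps is read off in \<open>W\<^sub>J\<close>. Otherwise at most one letter of \<open>J\<close> can be moved through \<open>u\<close>, and
  Deodhar's description of \<open>W\<^sub>J\<^sub>* u W\<^sub>J\<close> shows that every one of the first \<open>m(s,t)\<close> steps ascends.
\<close>

section \<open>Exchange condition and Demazure product\<close>

text \<open>\<open>demazure\<close> and \<open>diagram_aut\<close> are definite descriptions, and
  \<open>twisted_m\<close> evaluates them inside a dihedral subgroup. All combinatorics is therefore
  derived from the exchange condition, which restricts to parabolic subgroups at once; the
  presentation serves to establish that condition for \<open>W\<close>. The length of a braid
  depends on the prefix in front of it, so related words may be extended on the right only, and
  letters are stripped from the right end. Relating all ascending words for \<open>w\<close> gives
  just one inclusion. For the other, a braid step must preserve \<open>w\<close> wherever its
  pattern occurs in a shortest word, even where the prefix element has a descent in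
  \<open>J\<close>. If \<open>\<theta>\<close> preserves \<open>J\<close>, such a position would
  force the longest element of \<open>W_J\<close> to have length one; if it does not, both sides act
  as that longest element, whatever the starting point.\<close>

lemma word_prod_Nil [simp]: "word_prod G [] = \<one>\<^bsub>G\<^esub>"
  by (simp add: word_prod_def)

lemma word_prod_Cons [simp]: "word_prod G (x # xs) = x \<otimes>\<^bsub>G\<^esub> word_prod G xs"
  by (simp add: word_prod_def)

lemma (in group) word_prod_closed [simp]: "set xs \<subseteq> carrier G \<Longrightarrow> word_prod G xs \<in> carrier G"
  by (induction xs) auto

lemma (in group) word_prod_append:
  "\<lbrakk>set xs \<subseteq> carrier G; set ys \<subseteq> carrier G\<rbrakk> \<Longrightarrow>
    word_prod G (xs @ ys) = word_prod G xs \<otimes> word_prod G ys"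
  by (induction xs) (auto simp: m_assoc)

text \<open>The weak inequality in \<open>exchange\<close> does two jobs: it gives the deletion
  property and, since a deletion shortens the word, it rules out equal lengths of \<open>w\<close>
  and \<open>s \<otimes> w\<close>.\<close>

locale exchange_system = group W for W :: "('a, 'b) monoid_scheme" (structure) +
  fixes S :: "'a set"
  assumes gens_subset: "S \<subseteq> carrier W"
    and gens_generate: "generate W S = carrier W"
    and gen_mult_self: "s \<in> S \<Longrightarrow> s \<otimes> s = \<one>"
    and exchange: "\<lbrakk>s \<in> S; x \<in> lists S;
        cox_length W S (s \<otimes> word_prod W x) \<le> cox_length W S (word_prod W x)\<rbrakk> \<Longrightarrow>
      \<exists>y r z. x = y @ r # z \<and> s \<otimes> word_prod W x = word_prod W (y @ z)"
begin

abbreviation len :: "'a \<Rightarrow> nat" where "len \<equiv> cox_length W S"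

lemma gen_closed [simp, intro]: "s \<in> S \<Longrightarrow> s \<in> carrier W"
  using gens_subset by auto

lemma lists_closed [simp]: "x \<in> lists S \<Longrightarrow> set x \<subseteq> carrier W"
  using gens_subset by auto

lemma inv_gen [simp]: "s \<in> S \<Longrightarrow> inv s = s"
  by (intro inv_equality gen_mult_self) auto

lemma gen_cancel_left [simp]: "\<lbrakk>s \<in> S; w \<in> carrier W\<rbrakk> \<Longrightarrow> s \<otimes> (s \<otimes> w) = w"
  by (simp add: gen_mult_self flip: m_assoc)

lemma gen_cancel_right [simp]: "\<lbrakk>s \<in> S; w \<in> carrier W\<rbrakk> \<Longrightarrow> w \<otimes> s \<otimes> s = w"
  by (simp add: gen_mult_self m_assoc)

lemma word_prod_rev: "x \<in> lists S \<Longrightarrow> word_prod W (rev x) = inv (word_prod W x)"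
  by (induction x) (auto simp: word_prod_append inv_mult_group subset_iff)

lemma generate_word:
  assumes "J \<subseteq> S" "w \<in> generate W J"
  obtains x where "x \<in> lists J" "word_prod W x = w"
proof -
  have "\<exists>x \<in> lists J. word_prod W x = w"
    using assms(2)
  proof induction
    case one
    show ?case by (intro bexI[of _ "[]"]) auto
  next
    case (incl h)
    then have "h \<in> carrier W" using assms(1) by auto
    with incl show ?case by (intro bexI[of _ "[h]"]) auto
  next
    case (inv h)
    then have "h \<in> S" using assms(1) by auto
    with inv show ?case by (intro bexI[of _ "[h]"]) auto
  next
    case (eng h1 h2)
    then obtain x y where "x \<in> lists J" "word_prod W x = h1" "y \<in> lists J" "word_prod W y = h2"
      by auto
    moreover from this have "set x \<subseteq> carrier W" "set y \<subseteq> carrier W"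
      using assms(1) gens_subset by auto
    ultimately show ?case
      by (intro bexI[of _ "x @ y"]) (auto simp: word_prod_append)
  qed
  then show ?thesis using that by blast
qed

lemma word_prod_generate:
  assumes "x \<in> lists J" shows "word_prod W x \<in> generate W J"
  using assms by (induction x) (auto intro: generate.intros)

lemma generate_closed: "J \<subseteq> S \<Longrightarrow> w \<in> generate W J \<Longrightarrow> w \<in> carrier W"
  using gens_subset by (meson generate_in_carrier order_trans)

lemma len_le: "x \<in> lists S \<Longrightarrow> len (word_prod W x) \<le> length x"
  unfolding cox_length_def by (rule Least_le) auto

lemma reduced_word:
  assumes "w \<in> carrier W"
  obtains x where "x \<in> lists S" "length x = len w" "word_prod W x = w"
proof -
  obtain x where "x \<in> lists S" "word_prod W x = w"
    using generate_word[of S w] assms gens_generate by auto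
  then have "\<exists>n. \<exists>x\<in>lists S. length x = n \<and> word_prod W x = w" by blast
  then have "\<exists>x\<in>lists S. length x = len w \<and> word_prod W x = w"
    unfolding cox_length_def by (rule LeastI_ex)
  then show ?thesis using that by blast
qed

lemma len_one [simp]: "len \<one> = 0"
  using len_le[of "[]"] by simp

lemma len_eq_0: "w \<in> carrier W \<Longrightarrow> len w = 0 \<Longrightarrow> w = \<one>"
  by (metis reduced_word length_0_conv word_prod_Nil)

lemma len_inv [simp]: "w \<in> carrier W \<Longrightarrow> len (inv w) = len w"
proof -
  have "len (inv w) \<le> len w" if "w \<in> carrier W" for w
    by (metis reduced_word that word_prod_rev len_le length_rev in_lists_conv_set set_rev)
  then show "w \<in> carrier W \<Longrightarrow> len (inv w) = len w"
    by (metis inv_closed inv_inv le_antisym)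
qed

lemma len_mult:
  assumes "v \<in> carrier W" "w \<in> carrier W"
  shows "len (v \<otimes> w) \<le> len v + len w"
proof -
  obtain x y where "x \<in> lists S" "length x = len v" "word_prod W x = v"
    "y \<in> lists S" "length y = len w" "word_prod W y = w"
    using reduced_word assms by metis
  then show ?thesis using len_le[of "x @ y"] by (auto simp: word_prod_append subset_iff)
qed

lemma len_gen:
  assumes "s \<in> S" shows "len s = 1"
proof -
  have "\<not> len (s \<otimes> word_prod W []) \<le> len (word_prod W [])"
    using exchange[of s "[]"] assms by auto
  then show ?thesis using len_le[of "[s]"] assms by simp
qed

lemma len_gen_mult:
  assumes "s \<in> S" "w \<in> carrier W"
  shows "len (s \<otimes> w) = len w + 1 \<or> len w = len (s \<otimes> w) + 1"
proof -
  have 1: "len (s \<otimes> w) \<le> len w + 1" using len_mult[of s w] len_gen assms by simp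
  have 2: "len w \<le> len (s \<otimes> w) + 1"
    using len_mult[of s "s \<otimes> w"] len_gen assms by simp
  have "len (s \<otimes> w) < len w" if le: "len (s \<otimes> w) \<le> len w"
  proof -
    obtain x where x: "x \<in> lists S" "length x = len w" "word_prod W x = w"
      using reduced_word assms by metis
    obtain y r z where "x = y @ r # z" "s \<otimes> w = word_prod W (y @ z)"
      using exchange[of s x] x le assms by auto
    then show ?thesis using len_le[of "y @ z"] x by auto
  qed
  then show ?thesis using 1 2 by linarith
qed

lemma len_mult_gen:
  assumes "s \<in> S" "w \<in> carrier W"
  shows "len (w \<otimes> s) = len w + 1 \<or> len w = len (w \<otimes> s) + 1"
proof -
  have "len (w \<otimes> s) = len (s \<otimes> inv w)"
    using len_inv[of "w \<otimes> s"] assms by (simp add: inv_mult_group)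
  then show ?thesis using len_gen_mult[of s "inv w"] assms by simp
qed

text \<open>Exchange deletes a letter from a reduced word of \<open>w\<close> followed by
  \<open>t\<close>. A deletion inside \<open>w\<close> would make \<open>s \<otimes> w\<close>
  shorter than \<open>w\<close>, so the deleted letter is the final \<open>t\<close>.\<close>

lemma folding:
  assumes "s \<in> S" "t \<in> S" "w \<in> carrier W"
    and "len w < len (s \<otimes> w)" "len w < len (w \<otimes> t)" "len (s \<otimes> (w \<otimes> t)) \<le> len (w \<otimes> t)"
  shows "s \<otimes> w = w \<otimes> t"
proof -
  obtain x where x: "x \<in> lists S" "length x = len w" "word_prod W x = w"
    using reduced_word assms by metis
  have xt: "x @ [t] \<in> lists S" "word_prod W (x @ [t]) = w \<otimes> t"
    using x assms by (auto simp: word_prod_append subset_iff)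
  obtain y r z where yz: "x @ [t] = y @ r # z" "s \<otimes> (w \<otimes> t) = word_prod W (y @ z)"
    using exchange[of s "x @ [t]"] xt assms by auto
  show ?thesis
  proof (cases z rule: rev_cases)
    case Nil
    then have "s \<otimes> (w \<otimes> t) = w" using yz x by simp
    then have "s \<otimes> (s \<otimes> (w \<otimes> t)) = s \<otimes> w" by simp
    then show ?thesis using assms by simp
  next
    case (snoc z' t')
    then have x': "x = y @ r # z'" "t' = t" using yz by auto
    have "s \<otimes> w \<otimes> t = word_prod W (y @ z') \<otimes> t"
      using yz snoc x x' assms by (auto simp: word_prod_append m_assoc subset_iff)
    then have "s \<otimes> w = word_prod W (y @ z')"
      using assms x x' r_cancel by (auto simp: subset_iff)
    then show ?thesis using len_le[of "y @ z'"] x x' assms by auto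
  qed
qed

section \<open>Construction and uniqueness of the Demazure product\<close>

definition lmul :: "'a \<Rightarrow> 'a \<Rightarrow> 'a" where
  "lmul s w = (if len (s \<otimes> w) > len w then s \<otimes> w else w)"

definition rmul :: "'a \<Rightarrow> 'a \<Rightarrow> 'a" where
  "rmul s w = (if len (w \<otimes> s) > len w then w \<otimes> s else w)"

lemma lmul_closed [simp]: "s \<in> S \<Longrightarrow> w \<in> carrier W \<Longrightarrow> lmul s w \<in> carrier W"
  by (simp add: lmul_def)

lemma rmul_closed [simp]: "s \<in> S \<Longrightarrow> w \<in> carrier W \<Longrightarrow> rmul s w \<in> carrier W"
  by (simp add: rmul_def)

text \<open>The critical case is that both multiplications ascend alone but not together. There
  \<open>folding\<close> gives \<open>s \<otimes> w = w \<otimes> t\<close>, and both sides are this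
  element.\<close>

lemma lmul_rmul:
  assumes "s \<in> S" "t \<in> S" "w \<in> carrier W"
  shows "lmul s (rmul t w) = rmul t (lmul s w)"
proof -
  note a = len_gen_mult[OF assms(1,3)] len_mult_gen[OF assms(2,3)]
    len_gen_mult[of s "w \<otimes> t"] len_mult_gen[of t "s \<otimes> w"] m_assoc[of s w t]
  show ?thesis
  proof (cases "len w < len (s \<otimes> w) \<and> len w < len (w \<otimes> t) \<and> len (s \<otimes> (w \<otimes> t)) \<le> len (w \<otimes> t)")
    case True
    then have "s \<otimes> w = w \<otimes> t" using folding assms by blast
    moreover from this have "s \<otimes> (w \<otimes> t) = w" "s \<otimes> w \<otimes> t = w" using assms
      by (metis gen_cancel_left, metis gen_cancel_right)
    ultimately show ?thesis using True by (auto simp: lmul_def rmul_def)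
  next
    case False
    then show ?thesis using a assms by (auto simp: lmul_def rmul_def)
  qed
qed

lemma foldr_lmul_closed [simp]:
  "xs \<in> lists S \<Longrightarrow> w \<in> carrier W \<Longrightarrow> foldr lmul xs w \<in> carrier W"
  by (induction xs) auto

lemma foldr_lmul_rmul:
  assumes "xs \<in> lists S" "t \<in> S" "w \<in> carrier W"
  shows "foldr lmul xs (rmul t w) = rmul t (foldr lmul xs w)"
  using assms by (induction xs) (auto simp: lmul_rmul)

text \<open>Every element arises from the unit by right multiplications, which commute with left
  multiplications; so a product of left multiplications is determined by its value at the unit.\<close>

lemma foldr_lmul_determined:
  assumes "xs \<in> lists S" "ys \<in> lists S" "foldr lmul xs \<one> = foldr lmul ys \<one>" "w \<in> carrier W"
  shows "foldr lmul xs w = foldr lmul ys w"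
proof -
  have "foldr lmul xs w = foldr lmul ys w" if "w \<in> carrier W" "len w = n" for w n
    using that
  proof (induction n arbitrary: w)
    case 0
    then show ?case using len_eq_0 assms by metis
  next
    case (Suc n)
    obtain x where x: "x \<in> lists S" "length x = len w" "word_prod W x = w"
      using reduced_word Suc.prems by metis
    then obtain y s where y: "x = y @ [s]" using Suc.prems(2) by (cases x rule: rev_cases) auto
    let ?v = "word_prod W y"
    have v: "?v \<in> carrier W" "s \<in> S" "w = ?v \<otimes> s" "y \<in> lists S"
      using x y by (auto simp: word_prod_append subset_iff)
    then have "len ?v = n"
      using len_le[of y] x y Suc.prems len_mult_gen[of s ?v] by auto
    then have "w = rmul s ?v" using v Suc.prems by (simp add: rmul_def)
    then show ?case using Suc.IH[OF v(1) \<open>len ?v = n\<close>] foldr_lmul_rmul assms v by metis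
  qed
  then show ?thesis using assms by blast
qed

lemma foldr_lmul_reduced:
  assumes "x \<in> lists S" "length x = len (word_prod W x)"
  shows "foldr lmul x \<one> = word_prod W x"
  using assms
proof (induction x)
  case (Cons s x)
  then have "len (word_prod W x) = length x"
    using len_gen_mult[of s "word_prod W x"] len_le[of x] by auto
  then show ?case using Cons by (auto simp: lmul_def)
qed simp

definition reduced :: "'a \<Rightarrow> 'a list" where
  "reduced w = (SOME x. x \<in> lists S \<and> length x = len w \<and> word_prod W x = w)"

lemma reduced:
  assumes "w \<in> carrier W"
  shows "reduced w \<in> lists S" "length (reduced w) = len w" "word_prod W (reduced w) = w"
proof -
  have "\<exists>x. x \<in> lists S \<and> length x = len w \<and> word_prod W x = w"
    using reduced_word[OF assms] by metis
  from someI_ex[OF this, folded reduced_def]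
  show "reduced w \<in> lists S" "length (reduced w) = len w" "word_prod W (reduced w) = w"
    by auto
qed

text \<open>The chosen reduced word does not matter: the operators of two reduced words of
  \<open>x\<close> agree at the unit and hence everywhere. The value \<open>undefined\<close> is the
  one that \<open>is_demazure_product\<close> prescribes.\<close>

definition dprod :: "'a \<Rightarrow> 'a \<Rightarrow> 'a" (infixl \<open>\<odot>\<close> 70) where
  "dprod x y = (if x \<in> carrier W \<and> y \<in> carrier W then foldr lmul (reduced x) y else undefined)"

lemma foldr_lmul_dprod:
  assumes "xs \<in> lists S" "w \<in> carrier W"
  shows "foldr lmul xs w = foldr lmul xs \<one> \<odot> w"
proof -
  let ?x = "foldr lmul xs \<one>"
  have x: "?x \<in> carrier W" using assms by simp
  have "foldr lmul (reduced ?x) \<one> = ?x"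
    using foldr_lmul_reduced[of "reduced ?x"] reduced[OF x] by simp
  then show ?thesis
    using foldr_lmul_determined[OF assms(1) _ _ assms(2)] x reduced(1)[OF x] assms(2)
    by (simp add: dprod_def)
qed

lemma dprod_closed [simp]: "x \<in> carrier W \<Longrightarrow> y \<in> carrier W \<Longrightarrow> x \<odot> y \<in> carrier W"
  by (simp add: dprod_def reduced)

lemma dprod_one_right [simp]: "x \<in> carrier W \<Longrightarrow> x \<odot> \<one> = x"
  using foldr_lmul_reduced[of "reduced x"] by (simp add: dprod_def reduced)

lemma dprod_one_left [simp]: "x \<in> carrier W \<Longrightarrow> \<one> \<odot> x = x"
  using foldr_lmul_dprod[of "[]" x] by simp

lemma dprod_assoc:
  assumes "x \<in> carrier W" "y \<in> carrier W" "z \<in> carrier W"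
  shows "x \<odot> y \<odot> z = x \<odot> (y \<odot> z)"
proof -
  have "x \<odot> (y \<odot> z) = foldr lmul (reduced x @ reduced y) z"
    using assms by (simp add: dprod_def reduced)
  also have "\<dots> = foldr lmul (reduced x @ reduced y) \<one> \<odot> z"
    using assms reduced by (intro foldr_lmul_dprod) auto
  also have "foldr lmul (reduced x @ reduced y) \<one> = foldr lmul (reduced x) y"
    using foldr_lmul_reduced[of "reduced y"] assms by (simp add: reduced)
  also have "\<dots> = x \<odot> y" using assms by (simp add: dprod_def)
  finally show ?thesis ..
qed

lemma gen_dprod: "s \<in> S \<Longrightarrow> w \<in> carrier W \<Longrightarrow> s \<odot> w = lmul s w"
  using foldr_lmul_dprod[of "[s]" w] by (simp add: lmul_def[of s \<one>] len_gen)

lemma dprod_gen: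
  assumes "s \<in> S" "w \<in> carrier W" shows "w \<odot> s = rmul s w"
proof -
  have "s = rmul s \<one>" using assms by (simp add: rmul_def len_gen)
  then have "w \<odot> s = foldr lmul (reduced w) (rmul s \<one>)" using assms by (simp add: dprod_def)
  also have "\<dots> = rmul s (w \<odot> \<one>)"
    using assms reduced foldr_lmul_rmul by (simp add: dprod_def)
  finally show ?thesis using assms by simp
qed

lemma is_demazure_product_dprod: "is_demazure_product W S (\<odot>)"
  unfolding is_demazure_product_def
  by (auto simp: dprod_assoc gen_dprod dprod_gen lmul_def rmul_def)
    (auto simp: dprod_def)

text \<open>Associativity, the unit law and the clause for left factors in \<open>S\<close> turn
  \<open>f x y\<close> into the left multiplications of a reduced word of \<open>x\<close>, applied
  to \<open>y\<close>.\<close>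

lemma is_demazure_product_unique:
  assumes f: "is_demazure_product W S f"
  shows "f = (\<odot>)"
proof (intro ext)
  fix x y
  show "f x y = x \<odot> y"
  proof (cases "x \<in> carrier W \<and> y \<in> carrier W")
    case False
    then show ?thesis using f unfolding is_demazure_product_def by (auto simp: dprod_def)
  next
    case True
    have fs: "f s w = lmul s w" if "s \<in> S" "w \<in> carrier W" for s w
      using f that unfolding is_demazure_product_def lmul_def by simp
    have "f (foldr lmul xs \<one>) y = foldr lmul xs y" if "xs \<in> lists S" for xs
      using that
    proof (induction xs rule: list.induct)
      case Nil
      then show ?case using f True unfolding is_demazure_product_def by simp
    next
      case (Cons s xs)
      let ?v = "foldr lmul xs \<one>"
      have "s \<in> carrier W" "?v \<in> carrier W" using Cons.prems by auto
      then have "f (f s ?v) y = f s (f ?v y)"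
        using f True unfolding is_demazure_product_def by blast
      then show ?case using Cons True by (auto simp: fs)
    qed
    from this[of "reduced x"] show ?thesis
      using True foldr_lmul_reduced[of "reduced x"] by (simp add: dprod_def reduced)
  qed
qed

lemma demazure_eq: "demazure W S = (\<odot>)"
  unfolding demazure_def
  by (intro the_equality is_demazure_product_dprod is_demazure_product_unique)

end

section \<open>Parabolic subgroups and double cosets\<close>

lemma rev_in_lists_iff [simp]: "rev x \<in> lists A \<longleftrightarrow> x \<in> lists A"
  by auto

lemma (in group) inv_mult_cancel_left [simp]:
  "\<lbrakk>x \<in> carrier G; y \<in> carrier G\<rbrakk> \<Longrightarrow> inv x \<otimes> (x \<otimes> y) = y"
  by (simp flip: m_assoc)

lemma (in group) mult_inv_cancel_left [simp]:
  "\<lbrakk>x \<in> carrier G; y \<in> carrier G\<rbrakk> \<Longrightarrow> x \<otimes> (inv x \<otimes> y) = y"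
  by (simp flip: m_assoc)

context exchange_system
begin

lemma lmul_eq: "s \<in> S \<Longrightarrow> w \<in> carrier W \<Longrightarrow>
    s \<odot> w = (if len w < len (s \<otimes> w) then s \<otimes> w else w)"
  by (simp add: gen_dprod lmul_def)

lemma rmul_eq: "s \<in> S \<Longrightarrow> w \<in> carrier W \<Longrightarrow>
    w \<odot> s = (if len w < len (w \<otimes> s) then w \<otimes> s else w)"
  by (simp add: dprod_gen rmul_def)

lemma dprod_reduced:
  assumes "v \<in> carrier W" "w \<in> carrier W" "len (v \<otimes> w) = len v + len w"
  shows "v \<odot> w = v \<otimes> w"
proof -
  have "word_prod W x \<odot> w = word_prod W x \<otimes> w"
    if "x \<in> lists S" "len (word_prod W x \<otimes> w) = length x + len w" for x
    using that
  proof (induction x rule: list.induct)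
    case (Cons s x)
    let ?x = "word_prod W x"
    have x: "x \<in> lists S" "?x \<in> carrier W" "s \<in> S" using Cons.prems by auto
    have "len (s \<otimes> (?x \<otimes> w)) = Suc (length x) + len w"
      using Cons.prems x assms by (simp add: m_assoc)
    moreover have "len (?x \<otimes> w) \<le> length x + len w"
      using len_mult[of ?x w] len_le[OF x(1)] x assms by simp
    ultimately have *: "len (?x \<otimes> w) = length x + len w" "len (?x \<otimes> w) < len (s \<otimes> (?x \<otimes> w))"
      using len_gen_mult[of s "?x \<otimes> w"] x assms by auto
    have "length (s # x) + len w \<le> len (s \<otimes> ?x) + len w"
      using Cons.prems x assms len_mult[of "s \<otimes> ?x" w] by simp
    then have "len ?x < len (s \<otimes> ?x)" using len_le[OF x(1)] by simp
    then have "(s \<otimes> ?x) \<odot> w = s \<odot> ?x \<odot> w" using x by (simp add: lmul_eq)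
    also have "\<dots> = s \<odot> (?x \<otimes> w)" using Cons.IH * x assms by (simp add: dprod_assoc)
    also have "\<dots> = s \<otimes> (?x \<otimes> w)" using * x assms by (simp add: lmul_eq)
    finally show ?case using x assms by (simp add: m_assoc)
  qed (use assms in simp)
  then show ?thesis using assms reduced_word by metis
qed

text \<open>A shortest word with letters in \<open>J\<close> is already reduced over
  \<open>S\<close>: otherwise exchange would delete one of its letters, and a deletion introduces no
  letters outside \<open>J\<close>.\<close>

lemma reduced_J_word:
  assumes "J \<subseteq> S" "w \<in> generate W J"
  obtains x where "x \<in> lists J" "length x = len w" "word_prod W x = w"
proof -
  have JS: "lists J \<subseteq> lists S" using assms(1) by (rule lists_mono)
  define shortest where "shortest = (\<lambda>x. x \<in> lists J \<and>
    (\<forall>y \<in> lists J. word_prod W y = word_prod W x \<longrightarrow> length x \<le> length y))"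
  have "length x = len (word_prod W x)" if "shortest x" for x
    using that
  proof (induction x rule: list.induct)
    case (Cons s x)
    have xJ: "s \<in> J" "x \<in> lists J" using Cons.prems by (auto simp: shortest_def)
    have "shortest x"
      unfolding shortest_def
    proof (intro conjI ballI impI)
      fix y assume "y \<in> lists J" "word_prod W y = word_prod W x"
      then have "s # y \<in> lists J" "word_prod W (s # y) = word_prod W (s # x)" using xJ by auto
      then show "length x \<le> length y" using Cons.prems unfolding shortest_def by fastforce
    qed (use xJ in auto)
    then have l: "length x = len (word_prod W x)" by (rule Cons.IH)
    have xS: "x \<in> lists S" "s \<in> S" using xJ assms JS by auto
    have False if le: "len (s \<otimes> word_prod W x) \<le> len (word_prod W x)"
    proof -
      obtain y r z where yz: "x = y @ r # z" "s \<otimes> word_prod W x = word_prod W (y @ z)"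
        using exchange[of s x] le xS by blast
      have "y @ z \<in> lists J" using xJ yz by auto
      then have "length (s # x) \<le> length (y @ z)"
        using Cons.prems yz(2) unfolding shortest_def by (metis word_prod_Cons)
      then show False using yz(1) by simp
    qed
    then have "\<not> len (s \<otimes> word_prod W x) \<le> len (word_prod W x)" by blast
    then show ?case using l len_gen_mult[OF xS(2) word_prod_closed[OF lists_closed[OF xS(1)]]] by simp
  qed simp
  moreover have "\<exists>x. shortest x \<and> word_prod W x = w"
  proof -
    obtain x0 where "x0 \<in> lists J \<and> word_prod W x0 = w" using generate_word assms by metis
    from ex_has_least_nat[where P = "\<lambda>x. x \<in> lists J \<and> word_prod W x = w", OF this, of length]
    show ?thesis unfolding shortest_def by auto
  qed
  ultimately show ?thesis using that unfolding shortest_def by metis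
qed

section \<open>Minimal coset representatives\<close>

lemma generate_mult: "x \<in> generate W J \<Longrightarrow> y \<in> generate W J \<Longrightarrow> x \<otimes> y \<in> generate W J"
  by (rule generate.eng)

lemma generate_inv: "J \<subseteq> S \<Longrightarrow> x \<in> generate W J \<Longrightarrow> inv x \<in> generate W J"
  using gens_subset by (meson generate_m_inv_closed order_trans)

text \<open>\<open>v\<close> is a shortest element of the coset of \<open>w\<close>. If lengths
  ceased to add when a letter is appended, exchange would delete a letter either from the part in
  \<open>J\<close>, which is reduced, or from \<open>v\<close>, which would give a shorter element
  of the coset.\<close>

lemma min_coset_rep:
  assumes "J \<subseteq> S" "w \<in> carrier W"
  obtains v x where "v \<in> carrier W" "x \<in> generate W J" "w = v \<otimes> x"
    "\<And>y. y \<in> generate W J \<Longrightarrow> len (v \<otimes> y) = len v + len y"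
proof -
  define C where "C = (\<lambda>v. v \<in> carrier W \<and> (\<exists>x \<in> generate W J. w = v \<otimes> x))"
  have "C w" unfolding C_def using assms by (intro conjI bexI[of _ \<one>]) (auto intro: generate.one)
  from ex_has_least_nat[where P = C, OF this, of len]
  obtain v where v: "C v" "\<And>u. C u \<Longrightarrow> len v \<le> len u" by auto
  then obtain x where x: "x \<in> generate W J" "w = v \<otimes> x" "v \<in> carrier W" by (auto simp: C_def)
  have Cv: "C (v \<otimes> y)" if "y \<in> generate W J" for y
    unfolding C_def
  proof (intro conjI bexI)
    have "y \<in> carrier W" "x \<in> carrier W" using that x generate_closed assms by auto
    then show "w = v \<otimes> y \<otimes> (inv y \<otimes> x)" "v \<otimes> y \<in> carrier W"
      using x(2,3) by (auto simp: m_assoc)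
    show "inv y \<otimes> x \<in> generate W J" using that x assms generate_inv generate_mult by metis
  qed
  \<comment> \<open>The word is stored backwards: appending a letter on the right becomes a list
    \<open>Cons\<close>, and the inverse of the product, on which exchange acts from the left,
    starts with \<open>y\<close> itself.\<close>
  have "len (v \<otimes> word_prod W (rev y)) = len v + length y"
    if "y \<in> lists J" "length y = len (word_prod W (rev y))" for y
    using that
  proof (induction y rule: list.induct)
    case (Cons r y)
    let ?y = "word_prod W (rev y)"
    have y: "y \<in> lists J" "r \<in> J" "r \<in> S" "y \<in> lists S" "rev y \<in> lists S" "rev y \<in> lists J"
      using Cons.prems assms(1) by auto
    then have yr: "word_prod W (rev (r # y)) = ?y \<otimes> r" "?y \<in> carrier W"
      by (simp_all add: word_prod_append)
    then have ly: "length y = len ?y"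
      using Cons.prems(2) len_le[of "rev y"] len_mult_gen[of r ?y] y by auto
    then have IH: "len (v \<otimes> ?y) = len v + length y" using Cons.IH y by blast
    show ?case
    proof (rule ccontr)
      assume "len (v \<otimes> word_prod W (rev (r # y))) \<noteq> len v + length (r # y)"
      then have le: "len (v \<otimes> ?y \<otimes> r) \<le> len (v \<otimes> ?y)"
        using len_mult_gen[of r "v \<otimes> ?y"] yr y x IH by (auto simp: m_assoc)
      obtain p where p: "p \<in> lists S" "length p = len v" "word_prod W p = v"
        using reduced_word x by metis
      have w1: "word_prod W (y @ rev p) = inv (v \<otimes> ?y)"
        using p y x yr word_prod_rev[of "rev y"] word_prod_rev[of p]
        by (simp add: word_prod_append inv_mult_group)
      have w2: "r \<otimes> inv (v \<otimes> ?y) = inv (v \<otimes> ?y \<otimes> r)"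
        using y x yr by (simp add: inv_mult_group)
      have ypS: "y @ rev p \<in> lists S" using y p by simp
      have le': "len (r \<otimes> word_prod W (y @ rev p)) \<le> len (word_prod W (y @ rev p))"
        using w1 w2 le x yr y by simp
      obtain f g h where fgh: "y @ rev p = f @ g # h"
        "inv (v \<otimes> ?y \<otimes> r) = word_prod W (f @ h)"
        using exchange[OF y(3) ypS] le' w2[folded w1] by auto
      from fgh(1) consider k where "y = f @ g # k" "h = k @ rev p"
        | k where "f = y @ k" "rev p = k @ g # h"
        by (auto simp: append_eq_append_conv2 append_eq_Cons_conv)
      then show False
      proof cases
        case 1
        have fk: "f \<in> lists S" "k \<in> lists S" using 1 y by auto
        then have "word_prod W (f @ h) = word_prod W (f @ k) \<otimes> word_prod W (rev p)"
          using 1 p(1) by (simp add: word_prod_append m_assoc del: set_rev)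
        then have "inv (v \<otimes> ?y \<otimes> r) = word_prod W (f @ k) \<otimes> inv v"
          using fgh(2) p word_prod_rev[OF p(1)] by simp
        moreover have "inv (v \<otimes> ?y \<otimes> r) = inv (?y \<otimes> r) \<otimes> inv v"
          using x yr y by (simp add: inv_mult_group m_assoc)
        ultimately have "inv (?y \<otimes> r) = word_prod W (f @ k)"
          using fk x(3) yr y by simp
        then have "len (?y \<otimes> r) \<le> length (f @ k)"
          using len_le[of "f @ k"] fk yr y len_inv[of "?y \<otimes> r"] by simp
        then show False using 1 Cons.prems(2) yr by simp
      next
        case 2
        have kh: "k \<in> lists S" "h \<in> lists S"
          using 2(2) p(1) by (metis append_in_lists_conv Cons_in_lists_iff in_lists_conv_set set_rev)+
        have q: "inv (v \<otimes> ?y \<otimes> r) = word_prod W y \<otimes> word_prod W (k @ h)"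
          using fgh(2) 2 y kh by (simp add: word_prod_append m_assoc)
        \<comment> \<open>The deleted letter lies in \<open>v\<close>; moving the factors from
          \<open>J\<close> to the other side exhibits an element of the coset that is shorter than
          \<open>v\<close>.\<close>
        have "C (inv (word_prod W (k @ h)))"
        proof -
          have "inv (word_prod W (k @ h)) = v \<otimes> (?y \<otimes> r \<otimes> word_prod W y)"
          proof -
            have "v \<otimes> ?y \<otimes> r = inv (word_prod W (k @ h)) \<otimes> inv (word_prod W y)"
              using arg_cong[OF q, of "\<lambda>z. inv z"] y kh x yr by (simp add: inv_mult_group)
            then have "v \<otimes> ?y \<otimes> r \<otimes> word_prod W y = inv (word_prod W (k @ h))"
              using y kh by (simp add: m_assoc)
            then show ?thesis using y x yr by (simp add: m_assoc)
          qed
          then show ?thesis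
            using Cv[of "?y \<otimes> r \<otimes> word_prod W y"] y
            by (simp add: word_prod_generate generate_mult generate.incl)
        qed
        then have "len v \<le> len (inv (word_prod W (k @ h)))" by (rule v(2))
        also have "\<dots> = len (word_prod W (k @ h))" using kh by simp
        also have "\<dots> \<le> length (k @ h)" using kh by (intro len_le) simp
        finally have "len v \<le> length (k @ h)" .
        then show False using arg_cong[OF 2(2), of length] p by simp
      qed
    qed
  qed (use x in simp)
  note key = this
  have "len (v \<otimes> y) = len v + len y" if yJ: "y \<in> generate W J" for y
  proof -
    obtain z where z: "z \<in> lists J" "length z = len y" "word_prod W z = y"
      using reduced_J_word[OF assms(1) yJ] by metis
    have "rev z \<in> lists J" using z by auto
    then show ?thesis using key[of "rev z"] z by simp
  qed
  then show ?thesis using that x by blast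
qed

text \<open>A local test for minimality: if \<open>u\<close> were not shortest in its coset, the
  last letter of a reduced word of the coset factor would be a descent of \<open>u\<close> in
  \<open>J\<close>.\<close>

lemma len_mult_parabolic:
  assumes "J \<subseteq> S" "u \<in> carrier W" "\<And>r. r \<in> J \<Longrightarrow> len u < len (u \<otimes> r)" "x \<in> generate W J"
  shows "len (u \<otimes> x) = len u + len x"
proof -
  obtain v y where v: "v \<in> carrier W" "y \<in> generate W J" "u = v \<otimes> y"
    "\<And>y. y \<in> generate W J \<Longrightarrow> len (v \<otimes> y) = len v + len y"
    using min_coset_rep[OF assms(1,2)] by metis
  obtain z where z: "z \<in> lists J" "length z = len y" "word_prod W z = y"
    using reduced_J_word[OF assms(1) v(2)] by metis
  have "z = []"
  proof (rule ccontr)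
    assume "z \<noteq> []"
    then obtain z' r where z': "z = z' @ [r]" by (metis rev_exhaust)
    then have r: "r \<in> J" "r \<in> S" "z' \<in> lists S" "z' \<in> lists J" using z assms(1) by auto
    have "y = word_prod W z' \<otimes> r" using z(3) z' r by (simp add: word_prod_append)
    then have "u \<otimes> r = v \<otimes> word_prod W z'"
      using v(1,3) r by (simp add: m_assoc gen_mult_self)
    then have "len (u \<otimes> r) = len v + len (word_prod W z')"
      using v(4)[of "word_prod W z'"] r word_prod_generate by simp
    also have "\<dots> \<le> len v + length z'" using len_le[of z'] r by simp
    also have "\<dots> < len u" using v(2,3,4) z z' by simp
    finally show False using assms(3)[OF r(1)] by simp
  qed
  then have "y = \<one>" using z by simp
  then have "u = v" using v(1,3) by simp
  then show ?thesis using v assms by simp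
qed

lemma len_mult_parabolic_left:
  assumes "J \<subseteq> S" "u \<in> carrier W" "\<And>r. r \<in> J \<Longrightarrow> len u < len (r \<otimes> u)" "x \<in> generate W J"
  shows "len (x \<otimes> u) = len x + len u"
proof -
  have x: "x \<in> carrier W" using assms generate_closed by blast
  have "len (inv u \<otimes> inv x) = len (inv u) + len (inv x)"
  proof (rule len_mult_parabolic[OF assms(1)])
    fix r assume r: "r \<in> J"
    then have "inv u \<otimes> r = inv (r \<otimes> u)" using assms by (auto simp: inv_mult_group)
    then show "len (inv u) < len (inv u \<otimes> r)" using assms r by auto
  qed (use assms generate_inv in auto)
  then show ?thesis using x assms len_inv[of "x \<otimes> u"] by (simp add: inv_mult_group)
qed

text \<open>If prepending \<open>p\<close> to \<open>b \<otimes> u\<close> creates the descent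
  \<open>r\<close>, folding gives
  \<open>p \<otimes> b \<otimes> u = b \<otimes> u \<otimes> r\<close>. Hence
  \<open>u \<otimes> r = g \<otimes> u\<close> with \<open>g\<close> a conjugate of \<open>p\<close>
  by \<open>b\<close>, and the second condition on \<open>a\<close> forbids such a \<open>g\<close>
  as a descent once it is known to be a generator.\<close>

lemma no_descent_double_coset:
  assumes IJ: "I \<subseteq> S" "J \<subseteq> S" and u: "u \<in> carrier W"
    and uI: "\<And>r. r \<in> I \<Longrightarrow> len u < len (r \<otimes> u)"
    and uJ: "\<And>r. r \<in> J \<Longrightarrow> len u < len (u \<otimes> r)"
    and a: "a \<in> generate W I"
      "\<And>r r'. \<lbrakk>r \<in> J; r' \<in> I; u \<otimes> r = r' \<otimes> u\<rbrakk> \<Longrightarrow> len a < len (a \<otimes> r')"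
    and r: "r \<in> J"
  shows "len (a \<otimes> u) < len (a \<otimes> u \<otimes> r)"
proof -
  have "len (word_prod W l \<otimes> u) < len (word_prod W l \<otimes> u \<otimes> r)"
    if "l \<in> lists I" "length l = len (word_prod W l)"
      "\<And>r r'. \<lbrakk>r \<in> J; r' \<in> I; u \<otimes> r = r' \<otimes> u\<rbrakk> \<Longrightarrow>
        len (word_prod W l) < len (word_prod W l \<otimes> r')" "r \<in> J" for l r
    using that
  proof (induction l arbitrary: r rule: list.induct)
    case Nil
    then show ?case using u uJ by simp
  next
    case (Cons p l)
    let ?b = "word_prod W l" let ?y = "?b \<otimes> u"
    have l: "l \<in> lists I" "p \<in> I" "p \<in> S" "l \<in> lists S" "?b \<in> carrier W" "?y \<in> carrier W"
      "?b \<in> generate W I"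
      using Cons.prems IJ u word_prod_generate[of l I] lists_closed[of l] by (auto simp: subset_iff)
    have r: "r \<in> S" using Cons.prems IJ by auto
    have lb: "length l = len ?b"
      using Cons.prems(2) len_le[of l] len_gen_mult[of p ?b] l by auto
    have asc: "len ?b < len (?b \<otimes> r')" if "r \<in> J" "r' \<in> I" "u \<otimes> r = r' \<otimes> u" for r r'
    proof (rule ccontr)
      assume "\<not> ?thesis"
      moreover have r': "r' \<in> S" using that IJ by auto
      ultimately have "len (?b \<otimes> r') < len ?b"
        using len_mult_gen[of r' ?b] l by auto
      then have "len (p \<otimes> (?b \<otimes> r')) \<le> len ?b"
        using len_gen_mult[of p "?b \<otimes> r'"] l r' by auto
      moreover have "len (p \<otimes> ?b) < len (p \<otimes> ?b \<otimes> r')" using Cons.prems(3)[OF that] by simp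
      ultimately show False using Cons.prems(2) lb l r' by (simp add: m_assoc)
    qed
    have yJ: "len ?y < len (?y \<otimes> r)" if "r \<in> J" for r
      using Cons.IH l lb asc that by blast
    have len_left: "len (x \<otimes> u) = len x + len u" if "x \<in> generate W I" for x
      using len_mult_parabolic_left[OF IJ(1) u uI that] .
    have py: "p \<otimes> ?y = word_prod W (p # l) \<otimes> u" using l u by (simp add: m_assoc)
    then have "len (p \<otimes> ?y) = length (p # l) + len u"
      using len_left[of "word_prod W (p # l)"] Cons.prems word_prod_generate[of "p # l" I] by simp
    moreover have "len ?y = length l + len u" using len_left[of ?b] l lb by simp
    ultimately have lpy: "len ?y < len (p \<otimes> ?y)" by simp
    show ?case
    proof (rule ccontr)
      assume "\<not> ?case"
      then have "len (p \<otimes> (?y \<otimes> r)) \<le> len (p \<otimes> ?y)"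
        using l r u by (simp add: m_assoc)
      moreover have "len (p \<otimes> ?y) = len (?y \<otimes> r)"
        using lpy yJ[OF Cons.prems(4)] len_gen_mult[of p ?y] len_mult_gen[of r ?y] l r by auto
      ultimately have e: "p \<otimes> ?y = ?y \<otimes> r"
        using folding[of p r ?y] l r lpy yJ[OF Cons.prems(4)] by simp
      define g where "g = inv ?b \<otimes> (p \<otimes> ?b)"
      have g: "g \<in> generate W I" "g \<in> carrier W"
      proof -
        show "g \<in> generate W I"
          unfolding g_def using l(2,7) IJ(1) by (meson generate_mult generate_inv generate.incl)
        then show "g \<in> carrier W" using generate_closed[OF IJ(1)] by blast
      qed
      have "?b \<otimes> (u \<otimes> r) = p \<otimes> (?b \<otimes> u)" using e l r u by (simp add: m_assoc)
      then have "inv ?b \<otimes> (?b \<otimes> (u \<otimes> r)) = inv ?b \<otimes> (p \<otimes> (?b \<otimes> u))" by simp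
      then have ug: "u \<otimes> r = g \<otimes> u" unfolding g_def using l r u by (simp add: m_assoc)
      \<comment> \<open>Lengths add on \<open>W_I u\<close>, so \<open>g\<close> has length one and
        a reduced word of it is a single letter of \<open>I\<close>.\<close>
      then have "len g + len u = len u + 1"
        using len_left[of g] g uJ[OF Cons.prems(4)] len_mult_gen[of r u] r u by auto
      moreover obtain z where "z \<in> lists I" "length z = len g" "word_prod W z = g"
        using reduced_J_word[OF IJ(1) g(1)] by metis
      ultimately have "g \<in> I" using IJ by (auto simp: length_Suc_conv)
      then have "len (p \<otimes> ?b) < len (p \<otimes> ?b \<otimes> g)"
        using Cons.prems(3)[OF Cons.prems(4) _ ug] by simp
      moreover have "p \<otimes> ?b \<otimes> g = ?b" unfolding g_def using l by (simp add: m_assoc)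
      ultimately show False using lb Cons.prems(2) by simp
    qed
  qed
  then show ?thesis using reduced_J_word[OF IJ(1) a(1)] a(2) r by metis
qed

end

section \<open>Dihedral subgroups and the exchange condition for Coxeter systems\<close>

lemma length_alternating [simp]: "length (alternating s t n) = n"
  by (induction n arbitrary: s t) auto

lemma alternating_in_lists: "{s, t} \<subseteq> J \<Longrightarrow> alternating s t n \<in> lists J"
  by (induction n arbitrary: s t) auto

lemma alternating_snoc:
  "alternating s t (Suc n) = alternating s t n @ [if even n then s else t]"
  by (induction n arbitrary: s t) auto

lemma rev_alternating:
  "rev (alternating s t n) = (if even n then alternating t s n else alternating s t n)"
proof (induction n arbitrary: s t)
  case (Suc n)
  show ?case
    using Suc[of s t] Suc[of t s] alternating_snoc[of s t n] alternating_snoc[of t s n]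
    by (cases "even n") auto
qed simp

lemma map_alternating: "map f (alternating s t n) = alternating (f s) (f t) n"
  by (induction n arbitrary: s t) auto

lemma alternating_prefix:
  "alternating s t n = y @ z \<Longrightarrow> y = alternating s t (length y)"
  by (induction n arbitrary: s t y) (auto simp: Cons_eq_append_conv)

section \<open>Reduced words and the longest element of a dihedral subgroup\<close>

context exchange_system
begin

text \<open>Moving \<open>s\<close> past \<open>t \<otimes> s\<close> turns it into
  \<open>s \<otimes> t\<close>. Hence the two alternating products agree exactly when the order of
  \<open>s \<otimes> t\<close> divides \<open>n\<close>; the code \<open>0\<close> for infinite
  order fits, as \<open>0\<close> divides only \<open>0\<close>.\<close>

lemma word_prod_alternating:
  assumes "s \<in> S" "t \<in> S"
  shows "word_prod W (alternating s t n) = (s \<otimes> t) [^] n \<otimes> word_prod W (alternating t s n)"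
  using assms
proof (induction n arbitrary: s t)
  case (Suc n)
  have st: "alternating s t n \<in> lists S" "alternating t s n \<in> lists S"
    using Suc.prems by (simp_all add: alternating_in_lists)
  have comm: "s \<otimes> (t \<otimes> s) [^] n = (s \<otimes> t) [^] n \<otimes> s" for n :: nat
  proof (induction n)
    case (Suc n)
    have "s \<otimes> (t \<otimes> s) [^] Suc n = s \<otimes> (t \<otimes> s) [^] n \<otimes> (t \<otimes> s)"
      using \<open>s \<in> S\<close> \<open>t \<in> S\<close> by (simp add: m_assoc)
    then show ?case using Suc \<open>s \<in> S\<close> \<open>t \<in> S\<close> by (simp add: m_assoc)
  qed (use \<open>s \<in> S\<close> in simp)
  have "word_prod W (alternating s t (Suc n)) =
      s \<otimes> (t \<otimes> s) [^] n \<otimes> word_prod W (alternating s t n)"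
    using Suc.IH[of t s] Suc.prems st by (simp add: m_assoc)
  also have "\<dots> = (s \<otimes> t) [^] n \<otimes> (s \<otimes> word_prod W (alternating s t n))"
    using comm Suc.prems st by (simp add: m_assoc)
  also have "\<dots> = (s \<otimes> t) [^] Suc n \<otimes> word_prod W (alternating t s (Suc n))"
    using Suc.prems st by (simp add: m_assoc)
  finally show ?case .
qed simp

lemma word_prod_alternating_eq_iff:
  assumes "s \<in> S" "t \<in> S"
  shows "word_prod W (alternating s t n) = word_prod W (alternating t s n) \<longleftrightarrow>
    (s \<otimes> t) [^] n = \<one>"
  using word_prod_alternating[OF assms, of n] assms alternating_in_lists[of t s S n]
  by simp

lemma pow_eq_one_iff_cox_m_dvd:
  assumes "s \<in> S" "t \<in> S"
  shows "(s \<otimes> t) [^] n = \<one> \<longleftrightarrow> cox_m W s t dvd n"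
  using assms by (simp add: cox_m_def pow_eq_id)

lemma cox_m_commute:
  assumes "s \<in> S" "t \<in> S" shows "cox_m W s t = cox_m W t s"
  using assms ord_inv[of "s \<otimes> t"] by (simp add: cox_m_def inv_mult_group)

text \<open>A deletion would make the two alternating products of some positive length below
  \<open>m(s,t)\<close> coincide.\<close>

lemma len_alternating:
  assumes "s \<in> S" "t \<in> S" "s \<noteq> t" "n \<le> cox_m W s t \<or> cox_m W s t = 0"
  shows "len (word_prod W (alternating s t n)) = n"
  using assms
proof (induction n arbitrary: s t)
  case (Suc n)
  let ?x = "alternating t s n"
  have x: "?x \<in> lists S" using Suc.prems alternating_in_lists[of t s S n] by simp
  have len: "len (word_prod W ?x) = n"
    using Suc cox_m_commute[of s t] by auto
  have False if le: "len (s \<otimes> word_prod W ?x) \<le> len (word_prod W ?x)"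
  proof -
    obtain y r z where yz: "?x = y @ r # z" "s \<otimes> word_prod W ?x = word_prod W (y @ z)"
      using exchange[OF Suc.prems(1) x le] by auto
    define k where "k = length y"
    have yr: "y = alternating t s k" "y @ [r] = alternating t s (Suc k)"
      using alternating_prefix[of t s n y "r # z"] alternating_prefix[of t s n "y @ [r]" z] yz
      by (auto simp: k_def)
    have k: "Suc k \<le> n" using arg_cong[OF yz(1), of length] by (simp add: k_def)
    have yS: "y \<in> lists S" "r \<in> S" "z \<in> lists S" using x yz(1) by auto
    have "word_prod W (y @ r # z) = word_prod W (y @ [r]) \<otimes> word_prod W z"
      using word_prod_append[of "y @ [r]" z] yS by simp
    then have "s \<otimes> word_prod W (y @ [r]) \<otimes> word_prod W z = word_prod W y \<otimes> word_prod W z"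
      using yz yS Suc.prems by (simp add: word_prod_append m_assoc)
    then have "s \<otimes> word_prod W (y @ [r]) = word_prod W y"
      using yS Suc.prems by simp
    then have "s \<otimes> (s \<otimes> word_prod W (y @ [r])) = s \<otimes> word_prod W y" by simp
    moreover have "word_prod W (y @ [r]) \<in> carrier W" using yS by simp
    ultimately have "word_prod W (y @ [r]) = s \<otimes> word_prod W y" using Suc.prems by simp
    then have "word_prod W (alternating s t (Suc k)) = word_prod W (alternating t s (Suc k))"
      using yr by simp
    then have "cox_m W s t dvd Suc k"
      using word_prod_alternating_eq_iff pow_eq_one_iff_cox_m_dvd Suc.prems by blast
    then show False using k Suc.prems(4) by (cases "cox_m W s t = 0") (auto dest: dvd_imp_le)
  qed
  then have "len (word_prod W ?x) < len (s \<otimes> word_prod W ?x)" by (meson not_le)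
  then show ?case using len len_gen_mult[of s "word_prod W ?x"] x Suc.prems by simp
qed simp

lemma reduced_alternating:
  assumes "s \<in> S" "t \<in> S" "y \<in> lists {s, t}" "length y = len (word_prod W y)"
  shows "y = alternating s t (length y) \<or> y = alternating t s (length y)"
  using assms(3,4)
proof (induction y rule: list.induct)
  case (Cons r y)
  have y: "r \<in> S" "y \<in> lists S" "y \<in> lists {s, t}" "r \<in> {s, t}" using Cons.prems assms by auto
  then have "length y = len (word_prod W y)"
    using Cons.prems(2) len_le[of y] len_gen_mult[of r "word_prod W y"] by auto
  then have IH: "y = alternating s t (length y) \<or> y = alternating t s (length y)"
    using Cons.IH y by blast
  show ?case
  proof (cases y)
    case (Cons q z)
    have zS: "z \<in> lists S" using y Cons by simp
    have "q \<noteq> r"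
    proof
      assume "q = r"
      then have "len (word_prod W (r # y)) = len (word_prod W z)" using Cons y zS by simp
      then show False using len_le[OF zS] Cons.prems(2) Cons by simp
    qed
    then show ?thesis using IH y Cons by auto
  qed (use y in auto)
qed simp

lemma dihedral_reduced_word:
  assumes "s \<in> S" "t \<in> S" "x \<in> generate W {s, t}"
  shows "x = word_prod W (alternating s t (len x)) \<or> x = word_prod W (alternating t s (len x))"
  using reduced_J_word[OF _ assms(3)] reduced_alternating[OF assms(1,2)] assms(1,2)
  by (metis empty_subsetI insert_subset)

text \<open>The longest element of a finite dihedral subgroup. For infinite order the encoding
  \<open>0\<close> makes it the unit.\<close>

definition dih :: "'a \<Rightarrow> 'a \<Rightarrow> 'a" where
  "dih s t = word_prod W (alternating s t (cox_m W s t))"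

lemma dih_commute: "s \<in> S \<Longrightarrow> t \<in> S \<Longrightarrow> dih s t = dih t s"
  using word_prod_alternating_eq_iff[of s t] pow_eq_one_iff_cox_m_dvd cox_m_commute by (simp add: dih_def)

lemma dih_generate: "dih s t \<in> generate W {s, t}"
  unfolding dih_def by (intro word_prod_generate alternating_in_lists) simp

lemma dih_closed [simp]: "s \<in> S \<Longrightarrow> t \<in> S \<Longrightarrow> dih s t \<in> carrier W"
  unfolding dih_def by (intro word_prod_closed lists_closed alternating_in_lists) simp

lemma len_dih: "\<lbrakk>s \<in> S; t \<in> S; s \<noteq> t\<rbrakk> \<Longrightarrow> len (dih s t) = cox_m W s t"
  unfolding dih_def by (rule len_alternating) auto

lemma len_gen_dih:
  assumes "s \<in> S" "t \<in> S" "s \<noteq> t" "cox_m W s t \<noteq> 0"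
  shows "len (s \<otimes> dih s t) < len (dih s t)"
proof -
  obtain m where m: "cox_m W s t = Suc m" using assms(4) not0_implies_Suc by blast
  have *: "alternating t s m \<in> lists S" using assms by (intro alternating_in_lists) simp
  then have "s \<otimes> dih s t = word_prod W (alternating t s m)"
    using assms m by (simp add: dih_def)
  then show ?thesis using len_le[OF *] len_dih[OF assms(1-3)] m by simp
qed

text \<open>A longer reduced word would be alternating, and its first \<open>m(s,t) + 1\<close>
  letters collapse because the longest element has an alternating word starting with either
  letter.\<close>

lemma len_dihedral_le:
  assumes "s \<in> S" "t \<in> S" "s \<noteq> t" "cox_m W s t \<noteq> 0" "x \<in> generate W {s, t}"
  shows "len x \<le> cox_m W s t"
proof (rule ccontr)
  assume "\<not> ?thesis"
  then obtain k where k: "len x = Suc (cox_m W s t) + k"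
    by (metis less_iff_Suc_add not_le add_Suc)
  have long: False if st: "s \<in> S" "t \<in> S" "s \<noteq> t" "cox_m W s t \<noteq> 0"
      and x: "x = word_prod W (alternating s t (len x))" and k: "len x = Suc (cox_m W s t) + k" for s t
  proof -
    let ?y = "alternating s t (len x)"
    define z where "z = drop (Suc (cox_m W s t)) ?y"
    have yS: "?y \<in> lists S" using st by (intro alternating_in_lists) simp
    have "?y = take (Suc (cox_m W s t)) ?y @ z" by (simp add: z_def)
    moreover have "take (Suc (cox_m W s t)) ?y = alternating s t (Suc (cox_m W s t))"
      using alternating_prefix[of s t "len x" "take (Suc (cox_m W s t)) ?y" z] k
      by (simp add: z_def)
    ultimately have y: "?y = alternating s t (Suc (cox_m W s t)) @ z" by metis
    then have zS: "z \<in> lists S" using yS by (metis append_in_lists_conv)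
    have *: "alternating t s (cox_m W s t) \<in> lists S"  using st by (intro alternating_in_lists) simp
    have "x = s \<otimes> dih s t \<otimes> word_prod W z"
      using x y zS * st dih_commute[of s t] cox_m_commute[of s t]
      by (simp add: word_prod_append dih_def m_assoc)
    then have "len x \<le> len (s \<otimes> dih s t) + len (word_prod W z)"
      using len_mult[of "s \<otimes> dih s t" "word_prod W z"] st zS by simp
    moreover have "length z = k" using k by (simp add: z_def)
    ultimately show False using k len_gen_dih[OF st] len_dih[OF st(1-3)] len_le[OF zS] by simp
  qed
  show False
    using dihedral_reduced_word[OF assms(1,2,5)] long[of s t] long[of t s] assms k
      cox_m_commute[of s t] by auto
qed

lemma longest_element_dih:
  assumes "s \<in> S" "t \<in> S" "s \<noteq> t" "cox_m W s t \<noteq> 0"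
  shows "longest_element W S {s, t} = dih s t"
  unfolding longest_element_def
proof (rule the_equality)
  show "dih s t \<in> generate W {s, t} \<and> (\<forall>w\<in>generate W {s, t}. len w \<le> len (dih s t))"
    using dih_generate len_dih len_dihedral_le assms by simp
  fix d assume d: "d \<in> generate W {s, t} \<and> (\<forall>w\<in>generate W {s, t}. len w \<le> len d)"
  then have "len d = cox_m W s t"
    using dih_generate[of s t] len_dih[OF assms(1-3)] len_dihedral_le[OF assms] le_antisym by metis
  then show "d = dih s t"
    using dihedral_reduced_word[OF assms(1,2)] d dih_commute[OF assms(1,2)] cox_m_commute[OF assms(1,2)]
    unfolding dih_def by metis
qed

text \<open>In an infinite dihedral group each alternating word can be prolonged, so no element has
  both generators as descents; the minimal coset representative transfers this to \<open>W\<close>.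
  Inverses are taken because alternating words grow on the left.\<close>

lemma both_descents_finite:
  assumes "s \<in> S" "t \<in> S" "s \<noteq> t" "w \<in> carrier W"
    "len (w \<otimes> s) < len w" "len (w \<otimes> t) < len w"
  shows "cox_m W s t \<noteq> 0"
proof
  assume m: "cox_m W s t = 0"
  have J: "{s, t} \<subseteq> S" using assms by simp
  obtain v x where v: "v \<in> carrier W" "x \<in> generate W {s, t}" "w = v \<otimes> x"
    "\<And>y. y \<in> generate W {s, t} \<Longrightarrow> len (v \<otimes> y) = len v + len y"
    using min_coset_rep[OF J assms(4)] by metis
  have x: "x \<in> carrier W" "inv x \<in> generate W {s, t}"
    using v(2) J generate_closed generate_inv by blast+
  have desc: "len (r \<otimes> inv x) < len (inv x)" if "r \<in> {s, t}" for r
  proof -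
    have r: "r \<in> S" "r \<in> generate W {s, t}" using that J by (auto intro: generate.incl)
    have "len (v \<otimes> (x \<otimes> r)) < len (v \<otimes> x)"
      using that assms(5,6) v(1,3) r x by (auto simp: m_assoc)
    then have "len (x \<otimes> r) < len x" using v(4)[of x] v(4)[of "x \<otimes> r"] v(2) r generate_mult by auto
    then show ?thesis using len_inv[of "x \<otimes> r"] x r by (simp add: inv_mult_group)
  qed
  define n where "n = len (inv x)"
  have "inv x = word_prod W (alternating s t n) \<or> inv x = word_prod W (alternating t s n)"
    unfolding n_def by (rule dihedral_reduced_word[OF assms(1,2) x(2)])
  moreover have "len (t \<otimes> word_prod W (alternating s t n)) = Suc n"
    using len_alternating[of t s "Suc n"] assms m cox_m_commute[of s t] by simp
  moreover have "len (s \<otimes> word_prod W (alternating t s n)) = Suc n"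
    using len_alternating[of s t "Suc n"] assms m by simp
  ultimately show False using desc[of s] desc[of t] n_def by auto
qed

end

section \<open>Parity of reflections along a word\<close>

context coxeter_system
begin

lemma S_closed [simp, intro]: "s \<in> S \<Longrightarrow> s \<in> carrier W"
  using S_carrier by auto

lemma S_mult_self:
  assumes "s \<in> S" shows "s \<otimes> s = \<one>"
  using pow_ord_eq_1[of s] S_order_2[OF assms] assms by (simp add: numeral_2_eq_2)

lemma S_cancel [simp]: "\<lbrakk>s \<in> S; w \<in> carrier W\<rbrakk> \<Longrightarrow> s \<otimes> (s \<otimes> w) = w"
  by (simp add: S_mult_self flip: m_assoc)

text \<open>The parity of the number of \<open>i\<close> with
  \<open>p = s\<^sub>1\<dots>s\<^sub>i\<dots>s\<^sub>1\<close>, where \<open>x = [s\<^sub>1, \<dots>, s\<^sub>k]\<close>.\<close>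

fun refl_parity :: "'a list \<Rightarrow> 'a \<Rightarrow> bool" where
  "refl_parity [] p = False"
| "refl_parity (s # x) p = ((p = s) \<noteq> refl_parity x (s \<otimes> p \<otimes> s))"

lemma lists_S_closed [simp]: "x \<in> lists S \<Longrightarrow> set x \<subseteq> carrier W"
  using S_carrier by auto

text \<open>The cocycle identity: the reflections of a concatenation are those of \<open>x\<close>,
  together with those of \<open>y\<close> conjugated by the product of \<open>x\<close>.\<close>

lemma refl_parity_append:
  assumes "x \<in> lists S" "y \<in> lists S" "p \<in> carrier W"
  shows "refl_parity (x @ y) p =
    (refl_parity x p \<noteq> refl_parity y (inv (word_prod W x) \<otimes> p \<otimes> word_prod W x))"
  using assms
proof (induction x arbitrary: p rule: list.induct)
  case (Cons s x)
  have "s \<in> S" "x \<in> lists S" using Cons.prems by auto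
  moreover from this have "inv s = s" by (intro inv_equality S_mult_self) auto
  ultimately show ?case using Cons by (auto simp: inv_mult_group m_assoc)
qed simp

text \<open>With \<open>c = s \<otimes> t\<close>, the prefix of length \<open>k + 1\<close> of the
  word \<open>s, t, s, t, \<dots>\<close> contributes the reflection
  \<open>c [^] k \<otimes> s\<close>; so \<open>k\<close> counts positions from zero.\<close>

definition refl_in :: "'a \<Rightarrow> 'a \<Rightarrow> 'a \<Rightarrow> nat \<Rightarrow> bool" where
  "refl_in c s p k \<longleftrightarrow> p = c [^] k \<otimes> s"

text \<open>Stripping the first two letters conjugates \<open>p\<close> and thereby shifts the index
  by two; positions \<open>0\<close> and \<open>1\<close> are the tests that
  \<open>refl_parity\<close> makes at these letters.\<close>

lemma refl_parity_replicate:
  assumes "s \<in> S" "t \<in> S" "p \<in> carrier W"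
  shows "refl_parity (concat (replicate n [s, t])) p =
    odd (card {k. k < 2 * n \<and> refl_in (s \<otimes> t) s p k})"
  using assms(3)
proof (induction n arbitrary: p)
  case (Suc n)
  let ?c = "s \<otimes> t" let ?q = "t \<otimes> (s \<otimes> p \<otimes> s) \<otimes> t"
  let ?A = "{k. k < 2 * n \<and> refl_in ?c s ?q k}"
  let ?B = "{k. k < 2 * Suc n \<and> refl_in ?c s p k}"
  have c: "s \<in> carrier W" "t \<in> carrier W" "?c \<in> carrier W" using assms by auto
  have q: "?q \<in> carrier W" using c Suc.prems by simp
  have conj: "a \<otimes> p \<otimes> a = b \<longleftrightarrow> p = a \<otimes> b \<otimes> a" if "a \<in> S" "b \<in> carrier W" "p \<in> carrier W" for a b p
  proof
    assume "a \<otimes> p \<otimes> a = b"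
    then show "p = a \<otimes> b \<otimes> a" using that by (auto simp: m_assoc S_mult_self)
  next
    assume "p = a \<otimes> b \<otimes> a"
    then show "a \<otimes> p \<otimes> a = b" using that by (auto simp: m_assoc S_mult_self)
  qed
  have cs: "?c [^] k \<otimes> s \<otimes> t \<otimes> s = ?c [^] Suc k \<otimes> s" for k :: nat
    using c by (simp add: m_assoc)
  have step: "s \<otimes> (t \<otimes> (?c [^] k \<otimes> s) \<otimes> t) \<otimes> s = ?c [^] (k + 2) \<otimes> s" for k :: nat
  proof -
    have "?c [^] (k + 2) = ?c \<otimes> ?c [^] k \<otimes> ?c"
      using c nat_pow_mult[of ?c 1 k] nat_pow_mult[of ?c "1 + k" 1] by (simp add: add.commute)
    then show ?thesis using c by (simp add: m_assoc)
  qed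
  have shift: "refl_in ?c s ?q k \<longleftrightarrow> refl_in ?c s p (k + 2)" for k
    unfolding refl_in_def step[symmetric] using c assms Suc.prems
    by (simp add: conj)
  have B: "?B = (\<lambda>k. k + 2) ` ?A \<union> {k \<in> {0, 1}. refl_in ?c s p k}"
  proof (intro equalityI subsetI)
    fix k assume k: "k \<in> ?B"
    show "k \<in> (\<lambda>k. k + 2) ` ?A \<union> {k \<in> {0, 1}. refl_in ?c s p k}"
    proof (cases "k < 2")
      case False
      then obtain j where "k = j + 2" by (metis add.commute le_Suc_ex not_less)
      then show ?thesis using k shift by auto
    qed (use k in auto)
  qed (use shift in auto)
  have shifted: "card ((\<lambda>k. k + 2) ` ?A) = card ?A" by (rule card_image) (simp add: inj_on_def)
  have "card ?B = card ?A + card {k \<in> {0, 1::nat}. refl_in ?c s p k}"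
    unfolding B using shifted by (subst card_Un_disjoint) auto
  moreover have "{k \<in> {0, 1::nat}. refl_in ?c s p k} =
    (if refl_in ?c s p 0 then {0} else {}) \<union> (if refl_in ?c s p 1 then {1} else {})"
    by (auto intro!: gr0I)
  ultimately have "odd (card ?B) = ((refl_in ?c s p 0 \<noteq> refl_in ?c s p 1) \<noteq> odd (card ?A))"
    by auto
  moreover have "refl_in ?c s p 0 \<longleftrightarrow> p = s" using c by (simp add: refl_in_def)
  moreover have "refl_in ?c s p 1 \<longleftrightarrow> s \<otimes> p \<otimes> s = t"
    using c assms Suc.prems conj[of s t p] by (simp add: refl_in_def m_assoc)
  ultimately show ?case using Suc.IH[OF q] by auto
qed simp

lemma cox_cong_invariant:
  assumes "cox_cong W S x y"
  shows "x \<in> lists S \<and> y \<in> lists S \<and> word_prod W x = word_prod W y \<and>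
    (\<forall>p \<in> carrier W. refl_parity x p = refl_parity y p)"
  using assms
proof induction
  case (relator x y s t)
  let ?m = "cox_m W s t" let ?r = "concat (replicate (cox_m W s t) [s, t])"
  let ?c = "s \<otimes> t"
  have c: "?c \<in> carrier W" using relator by auto
  have r: "?r \<in> lists S" using relator by (auto simp: in_lists_conv_set)
  have pow: "word_prod W (concat (replicate n [s, t])) = ?c [^] n" for n
  proof (induction n)
    case (Suc n)
    have "s \<in> carrier W" "t \<in> carrier W" using relator by auto
    then show ?case using Suc nat_pow_Suc2[OF c, of n] c by (simp add: m_assoc)
  qed simp
  then have r1: "word_prod W ?r = \<one>" using c by (simp add: cox_m_def)
  have even: "\<not> refl_parity ?r p" if "p \<in> carrier W" for p
  proof -
    let ?A = "{k. k < ?m \<and> refl_in ?c s p k}"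
    \<comment> \<open>The relator has \<open>2 * m\<close> positions while its reflections repeat
      with period \<open>m\<close>, so each of them is met an even number of times.\<close>
    have per: "refl_in ?c s p (k + ?m) \<longleftrightarrow> refl_in ?c s p k" for k
      using c by (simp add: refl_in_def cox_m_def flip: nat_pow_mult)
    have "{k. k < 2 * ?m \<and> refl_in ?c s p k} = ?A \<union> (\<lambda>k. k + ?m) ` ?A"
    proof (intro equalityI subsetI)
      fix k assume k: "k \<in> {k. k < 2 * ?m \<and> refl_in ?c s p k}"
      show "k \<in> ?A \<union> (\<lambda>k. k + ?m) ` ?A"
      proof (cases "k < ?m")
        case False
        then obtain j where "k = j + ?m" by (metis add.commute le_Suc_ex not_less)
        then show ?thesis using k per by auto
      qed (use k in auto)
    qed (auto simp: per)
    then have "card {k. k < 2 * ?m \<and> refl_in ?c s p k} = card ?A + card ((\<lambda>k. k + ?m) ` ?A)"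
      by (simp, subst card_Un_disjoint) auto
    also have "card ((\<lambda>k. k + ?m) ` ?A) = card ?A" by (simp add: card_image)
    finally show ?thesis using refl_parity_replicate[of s t p ?m] relator that by simp
  qed
  have "word_prod W (x @ ?r @ y) = word_prod W (x @ y)"
    using relator r r1 word_prod_append[of x "?r @ y"] word_prod_append[of ?r y]
    by (simp add: word_prod_append)
  moreover have "refl_parity (x @ ?r @ y) p = refl_parity (x @ y) p" if p: "p \<in> carrier W" for p
    using relator(1,2) r r1 p even by (simp add: refl_parity_append)
  ultimately show ?case using relator r by auto
qed auto

text \<open>Here the presentation enters: \<open>x\<close> followed by the reverse of
  \<open>y\<close> represents the unit, so it is congruent to the empty word, along which every
  parity is even. The same holds for \<open>y\<close> in place of \<open>x\<close>.\<close>

lemma refl_parity_cong: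
  assumes "x \<in> lists S" "y \<in> lists S" "word_prod W x = word_prod W y" "p \<in> carrier W"
  shows "refl_parity x p = refl_parity y p"
proof -
  have inv_rev: "word_prod W (rev z) = inv (word_prod W z)" if "z \<in> lists S" for z
    using that
  proof (induction z rule: list.induct)
    case (Cons s z)
    have "s \<in> S" "z \<in> lists S" using Cons.prems by auto
    moreover from this have "inv s = s" by (intro inv_equality S_mult_self) auto
    ultimately show ?case using Cons by (simp add: word_prod_append inv_mult_group)
  qed simp
  have *: "refl_parity z p = refl_parity (rev y) (inv (word_prod W y) \<otimes> p \<otimes> word_prod W y)"
    if z: "z \<in> lists S" "word_prod W z = word_prod W y" for z
  proof -
    have "cox_cong W S (z @ rev y) []"
      using z assms inv_rev[OF assms(2)] by (intro presentation) (simp_all add: word_prod_append)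
    then have "\<not> refl_parity (z @ rev y) p" using cox_cong_invariant assms(4) by fastforce
    then show ?thesis using z assms by (simp add: refl_parity_append)
  qed
  show ?thesis using *[of x] *[of y] assms by simp
qed

text \<open>Odd parity makes \<open>p\<close> the reflection of at least one position, and
  multiplication by that reflection deletes the letter there.\<close>

lemma refl_parity_deletion:
  assumes "x \<in> lists S" "p \<in> carrier W" "refl_parity x p"
  shows "\<exists>y r z. x = y @ r # z \<and> p \<otimes> word_prod W x = word_prod W (y @ z)"
  using assms
proof (induction x arbitrary: p rule: list.induct)
  case (Cons s x)
  have s: "s \<in> S" "x \<in> lists S" using Cons.prems by auto
  show ?case
  proof (cases "p = s")
    case True
    then show ?thesis using s by (intro exI[of _ "[]"] exI[of _ s] exI[of _ x]) simp
  next
    case False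
    then obtain y r z where yz: "x = y @ r # z" "s \<otimes> p \<otimes> s \<otimes> word_prod W x = word_prod W (y @ z)"
      using Cons.IH[of "s \<otimes> p \<otimes> s"] Cons.prems s by auto
    have "s \<otimes> (s \<otimes> p \<otimes> s \<otimes> word_prod W x) = s \<otimes> word_prod W (y @ z)" using yz(2) by simp
    then have "p \<otimes> word_prod W (s # x) = word_prod W ((s # y) @ z)"
      using s Cons.prems by (simp add: m_assoc)
    then show ?thesis using yz by (intro exI[of _ "s # y"] exI[of _ r] exI[of _ z]) simp
  qed
qed simp

end

sublocale coxeter_system \<subseteq> exchange_system W S
proof
  show "S \<subseteq> carrier W" by (rule S_carrier)
  show "generate W S = carrier W" by (rule S_generates)
  show "s \<otimes> s = \<one>" if "s \<in> S" for s using that by (rule S_mult_self)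
  fix s x
  assume s: "s \<in> S" and x: "x \<in> lists S"
    and le: "cox_length W S (s \<otimes> word_prod W x) \<le> cox_length W S (word_prod W x)"
  have LE: "cox_length W S (word_prod W z) \<le> length z" if "z \<in> lists S" for z
    unfolding cox_length_def using that by (intro Least_le) auto
  have "\<exists>n. \<exists>y\<in>lists S. length y = n \<and> word_prod W y = s \<otimes> word_prod W x"
    using s x by (intro exI[of _ "length (s # x)"] bexI[of _ "s # x"]) auto
  then have "\<exists>y\<in>lists S. length y = cox_length W S (s \<otimes> word_prod W x) \<and>
      word_prod W y = s \<otimes> word_prod W x"
    unfolding cox_length_def by (rule LeastI_ex)
  then obtain y where y: "y \<in> lists S" "length y = cox_length W S (s \<otimes> word_prod W x)"
    "word_prod W y = s \<otimes> word_prod W x" by auto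
  \<comment> \<open>Were the parity of \<open>s\<close> even along \<open>x\<close>, it would be odd
    along \<open>s # x\<close>, hence along the reduced word \<open>y\<close> of the product. A
    deletion in \<open>y\<close> would then make the element of \<open>x\<close> shorter than the
    product, against \<open>le\<close>.\<close>
  have "refl_parity x s"
  proof (rule ccontr)
    assume "\<not> refl_parity x s"
    then have "refl_parity (s # x) s" using s by (simp add: S_mult_self)
    moreover have "s # x \<in> lists S" "word_prod W (s # x) = word_prod W y" using s x y by auto
    ultimately have "refl_parity y s" using refl_parity_cong y(1) s by blast
    then obtain f r g where fg: "y = f @ r # g" "s \<otimes> word_prod W y = word_prod W (f @ g)"
      using refl_parity_deletion[of y s] y(1) s by auto
    then have "word_prod W x = word_prod W (f @ g)" using y(3) s x by simp
    moreover have "f @ g \<in> lists S" using fg(1) y(1) by simp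
    ultimately have "cox_length W S (word_prod W x) \<le> length (f @ g)" using LE by metis
    then show False using le y(2) fg(1) by simp
  qed
  then show "\<exists>y r z. x = y @ r # z \<and> s \<otimes> word_prod W x = word_prod W (y @ z)"
    using refl_parity_deletion x s by blast
qed

section \<open>Twisted involutions and ascending words\<close>

lemma word_prod_subgroup_generated [simp]: "word_prod (subgroup_generated G J) x = word_prod G x"
  by (simp add: word_prod_def)

context exchange_system
begin

lemma carrier_parabolic: "J \<subseteq> S \<Longrightarrow> carrier (subgroup_generated W J) = generate W J"
  using gens_subset by (simp add: carrier_subgroup_generated Int_absorb1)

lemma cox_length_parabolic:
  assumes "J \<subseteq> S" "w \<in> generate W J"
  shows "cox_length (subgroup_generated W J) J w = len w"
proof -
  have "(LEAST n. \<exists>x\<in>lists J. length x = n \<and> word_prod W x = w) = len w"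
  proof (rule Least_equality)
    show "\<exists>x\<in>lists J. length x = len w \<and> word_prod W x = w"
      using reduced_J_word[OF assms] by metis
    fix n assume "\<exists>x\<in>lists J. length x = n \<and> word_prod W x = w"
    then obtain x where "x \<in> lists J" "length x = n" "word_prod W x = w" by blast
    moreover from this have "x \<in> lists S" using assms(1) lists_mono by blast
    ultimately show "len w \<le> n" using len_le by blast
  qed
  then show ?thesis by (simp add: cox_length_def)
qed

text \<open>Lengths over \<open>J\<close> and over \<open>S\<close> agree on \<open>W_J\<close>, and
  a deletion keeps the letters in \<open>J\<close>, so the exchange condition is inherited.\<close>

lemma exchange_system_parabolic:
  assumes J: "J \<subseteq> S"
  shows "exchange_system (subgroup_generated W J) J"
proof (intro exchange_system.intro exchange_system_axioms.intro group_subgroup_generated)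
  let ?H = "subgroup_generated W J"
  show JH: "J \<subseteq> carrier ?H" using J by (auto simp: carrier_parabolic intro: generate.incl)
  show "generate ?H J = carrier ?H"
    using arg_cong[OF subgroup_generated2[of J], of carrier] JH
    by (simp add: carrier_subgroup_generated[of ?H] Int_absorb1 del: subgroup_generated2)
  show "s \<otimes>\<^bsub>?H\<^esub> s = \<one>\<^bsub>?H\<^esub>" if "s \<in> J" for s using that J gen_mult_self by auto
  fix s x assume s: "s \<in> J" and x: "x \<in> lists J"
    and le: "cox_length ?H J (s \<otimes>\<^bsub>?H\<^esub> word_prod ?H x) \<le> cox_length ?H J (word_prod ?H x)"
  have "word_prod W x \<in> generate W J" using x by (rule word_prod_generate)
  moreover from this have "s \<otimes> word_prod W x \<in> generate W J"
    using s generate.incl generate_mult by metis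
  ultimately have "len (s \<otimes> word_prod W x) \<le> len (word_prod W x)"
    using le by (simp add: cox_length_parabolic[OF J])
  moreover have "s \<in> S" "x \<in> lists S" using s x J lists_mono by blast+
  ultimately show "\<exists>y r z. x = y @ r # z \<and> s \<otimes>\<^bsub>?H\<^esub> word_prod ?H x = word_prod ?H (y @ z)"
    using exchange by simp
qed

lemma foldr_lmul_generate:
  assumes "J \<subseteq> S" "x \<in> lists J" "w \<in> generate W J"
  shows "foldr lmul x w \<in> generate W J"
  using assms(2)
proof (induction x rule: list.induct)
  case (Cons s x)
  then show ?case using generate.incl[of s J W] generate_mult by (auto simp: lmul_def)
qed (use assms in simp)

text \<open>Removes the inner \<open>demazure\<close> from \<open>twisted_m\<close>: one-letter
  multiplications depend only on lengths, which agree, so both products can be computed from the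
  same word.\<close>

lemma demazure_parabolic:
  assumes J: "J \<subseteq> S" and xy: "x \<in> generate W J" "y \<in> generate W J"
  shows "demazure (subgroup_generated W J) J x y = x \<odot> y"
proof -
  interpret H: exchange_system "subgroup_generated W J" J
    by (rule exchange_system_parabolic[OF J])
  have fold: "foldr H.lmul l w = foldr lmul l w" if "l \<in> lists J" "w \<in> generate W J" for l w
    using that(1)
  proof (induction l rule: list.induct)
    case (Cons s l)
    let ?v = "foldr lmul l w"
    have "?v \<in> generate W J" using foldr_lmul_generate[OF J _ that(2)] Cons.prems by simp
    moreover from this have "s \<otimes> ?v \<in> generate W J"
      using Cons.prems generate.incl[of s J W] generate_mult by simp
    ultimately have "H.lmul s ?v = lmul s ?v"
      by (simp add: H.lmul_def lmul_def cox_length_parabolic[OF J])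
    then show ?case using Cons by simp
  qed simp
  have c: "x \<in> carrier (subgroup_generated W J)" "y \<in> carrier (subgroup_generated W J)"
    using xy J by (simp_all add: carrier_parabolic)
  have r: "H.reduced x \<in> lists J" "H.reduced x \<in> lists S"
    using H.reduced(1)[OF c(1)] J lists_mono by blast+
  have x: "x = foldr lmul (H.reduced x) \<one>"
    using H.dprod_one_right[OF c(1)] fold[OF r(1) generate.one] c(1) H.one_closed
    by (simp add: H.dprod_def split: if_splits)
  have "demazure (subgroup_generated W J) J x y = foldr lmul (H.reduced x) y"
    using c fold[OF r(1) xy(2)] by (simp add: H.demazure_eq H.dprod_def)
  also have "\<dots> = foldr lmul (H.reduced x) \<one> \<odot> y"
    using r xy J generate_closed by (intro foldr_lmul_dprod) auto
  finally show ?thesis using x by simp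
qed

section \<open>Demazure products of words\<close>

definition dword :: "'a list \<Rightarrow> 'a" where
  "dword ws = foldr lmul ws \<one>"

lemma dword_Nil [simp]: "dword [] = \<one>"
  by (simp add: dword_def)

lemma dword_closed [simp]: "x \<in> lists S \<Longrightarrow> dword x \<in> carrier W"
  by (simp add: dword_def)

lemma dword_generate: "J \<subseteq> S \<Longrightarrow> x \<in> lists J \<Longrightarrow> dword x \<in> generate W J"
  unfolding dword_def by (intro foldr_lmul_generate generate.one)

lemma dword_append:
  assumes "x \<in> lists S" "y \<in> lists S"
  shows "dword (x @ y) = dword x \<odot> dword y"
  using foldr_lmul_dprod[OF assms(1), of "dword y"] assms(2) by (simp add: dword_def)

lemma dword_Cons: "s \<in> S \<Longrightarrow> x \<in> lists S \<Longrightarrow> dword (s # x) = s \<odot> dword x"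
  by (simp add: dword_def gen_dprod)

lemma dword_snoc: "s \<in> S \<Longrightarrow> x \<in> lists S \<Longrightarrow> dword (x @ [s]) = dword x \<odot> s"
  using dword_Cons[of s "[]"] by (simp add: dword_append)

lemma dword_reduced: "x \<in> lists S \<Longrightarrow> length x = len (word_prod W x) \<Longrightarrow> dword x = word_prod W x"
  by (simp add: dword_def foldr_lmul_reduced)

lemma absorb_dword:
  assumes "w \<in> carrier W" "x \<in> lists S" "\<And>s. s \<in> set x \<Longrightarrow> w \<odot> s = w"
  shows "w \<odot> dword x = w"
  using assms(2,3)
proof (induction x rule: list.induct)
  case (Cons s x)
  have "s \<in> S" "x \<in> lists S" using Cons.prems(1) by auto
  then have "w \<odot> dword (s # x) = w \<odot> s \<odot> dword x"
    using assms(1) by (simp add: dword_Cons dprod_assoc)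
  moreover have "w \<odot> s = w" using Cons.prems(2)[of s] by simp
  ultimately show ?case using Cons by simp
qed (use assms in simp)

lemma dih_dprod_gen:
  assumes "s \<in> S" "t \<in> S" "s \<noteq> t" "cox_m W s t \<noteq> 0" "r \<in> {s, t}"
  shows "dih s t \<odot> r = dih s t"
proof -
  have r: "r \<in> S" "r \<in> generate W {s, t}" using assms by (auto intro: generate.incl)
  then have "len (dih s t \<otimes> r) \<le> len (dih s t)"
    using len_dihedral_le[OF assms(1-4)] dih_generate[of s t] generate_mult len_dih[OF assms(1-3)]
    by simp
  then show ?thesis using r assms by (simp add: rmul_eq)
qed

lemma dword_alternating_reduced:
  assumes "s \<in> S" "t \<in> S" "s \<noteq> t" "n \<le> cox_m W s t"
  shows "dword (alternating s t n) = word_prod W (alternating s t n)"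
  using assms by (intro dword_reduced) (simp_all add: alternating_in_lists len_alternating)

text \<open>After \<open>m(s,t)\<close> letters the product has reached the longest element, which
  absorbs the rest.\<close>

lemma dword_alternating_long:
  assumes "s \<in> S" "t \<in> S" "s \<noteq> t" "cox_m W s t \<noteq> 0" "cox_m W s t \<le> n"
  shows "dword (alternating s t n) = dih s t"
proof -
  let ?m = "cox_m W s t" let ?y = "take ?m (alternating s t n)" let ?z = "drop ?m (alternating s t n)"
  have y: "?y = alternating s t ?m"
    using alternating_prefix[of s t n ?y ?z] assms by simp
  have J: "alternating s t n \<in> lists {s, t}" by (simp add: alternating_in_lists)
  then have z: "?z \<in> lists {s, t}" "?z \<in> lists S"
    using assms(1,2) by (auto dest: in_set_dropD)
  have yS: "alternating s t ?m \<in> lists S" using assms by (simp add: alternating_in_lists)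
  have "dword (alternating s t n) = dword (?y @ ?z)" by simp
  also have "\<dots> = dih s t \<odot> dword ?z"
    unfolding y using dword_append[OF yS z(2)] dword_alternating_reduced[of s t ?m] assms
    by (simp add: dih_def)
  also have "\<dots> = dih s t"
    using z assms dih_dprod_gen[OF assms(1-4)] by (intro absorb_dword) auto
  finally show ?thesis .
qed

lemma dword_alternating_eq_dih_iff:
  assumes "s \<in> S" "t \<in> S" "s \<noteq> t" "cox_m W s t \<noteq> 0"
  shows "dword (alternating s t n) = dih s t \<longleftrightarrow> cox_m W s t \<le> n"
proof
  assume *: "dword (alternating s t n) = dih s t"
  show "cox_m W s t \<le> n"
  proof (rule ccontr)
    assume n: "\<not> ?thesis"
    then have "len (dword (alternating s t n)) = n"
      using assms len_alternating[of s t n] dword_alternating_reduced[of s t n] by simp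
    then show False using * len_dih[OF assms(1-3)] n by simp
  qed
qed (use assms dword_alternating_long in blast)

lemma dprod_dih_dword:
  assumes "s \<in> S" "t \<in> S" "s \<noteq> t" "cox_m W s t \<noteq> 0" "x \<in> lists {s, t}"
  shows "dword x \<odot> dih s t = dih s t"
proof -
  have gen: "r \<odot> dih s t = dih s t" if "r \<in> {s, t}" for r
  proof -
    have "len (r \<otimes> dih s t) < len (dih s t)"
      using that len_gen_dih[of s t] len_gen_dih[of t s] assms dih_commute[of s t] cox_m_commute[of s t]
      by auto
    then show ?thesis using that assms by (auto simp: lmul_eq)
  qed
  show ?thesis using assms(5)
  proof (induction x rule: list.induct)
    case (Cons r x)
    have x: "r \<in> S" "x \<in> lists S" "x \<in> lists {s, t}" using Cons.prems assms by auto
    then have "dword (r # x) \<odot> dih s t = r \<odot> (dword x \<odot> dih s t)"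
      using assms by (simp add: dword_Cons dprod_assoc)
    then show ?case using Cons.IH x Cons.prems gen by simp
  qed (use assms in simp)
qed

lemma inv_dprod_gen: "s \<in> S \<Longrightarrow> w \<in> carrier W \<Longrightarrow> inv (w \<odot> s) = s \<odot> inv w"
  using len_inv[of "w \<otimes> s"] by (simp add: lmul_eq rmul_eq inv_mult_group)

end

section \<open>Twisted conjugation as an action of the Demazure monoid\<close>

context twisted_coxeter_system
begin

lemma star_closed [simp]: "x \<in> carrier W \<Longrightarrow> star x \<in> carrier W"
  using star_iso by (auto simp: iso_def hom_def)

lemma star_mult: "\<lbrakk>x \<in> carrier W; y \<in> carrier W\<rbrakk> \<Longrightarrow> star (x \<otimes> y) = star x \<otimes> star y"
  using star_iso by (auto simp: iso_def hom_def)

lemma star_one [simp]: "star \<one> = \<one>"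
  using star_mult[of \<one> \<one>] by (simp add: l_cancel_one)

lemma star_inv: "x \<in> carrier W \<Longrightarrow> star (inv x) = inv (star x)"
  using star_mult[of "inv x" x] by (intro inv_equality[symmetric]) simp_all

lemma star_gen [simp]: "s \<in> S \<Longrightarrow> star s \<in> S"
  using star_S by auto

lemma star_eq_iff: "x \<in> carrier W \<Longrightarrow> y \<in> carrier W \<Longrightarrow> star x = star y \<longleftrightarrow> x = y"
  using star_star by metis

lemma len_star [simp]:
  assumes "w \<in> carrier W" shows "len (star w) = len w"
proof -
  have le: "len (star w) \<le> len w" if w: "w \<in> carrier W" for w
  proof -
    obtain x where x: "x \<in> lists S" "length x = len w" "word_prod W x = w"
      using reduced_word w by metis
    have "word_prod W (map star x) = star (word_prod W x)" if "x \<in> lists S" for x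
      using that by (induction x rule: list.induct) (simp_all add: star_mult)
    moreover have "map star x \<in> lists S" using x by auto
    ultimately show ?thesis using x len_le[of "map star x"] by simp
  qed
  show ?thesis using le[OF assms] le[of "star w"] assms star_star by simp
qed

lemma twisted_conj_eq: "twisted_conj W S star x w = inv (star w) \<odot> x \<odot> w"
  by (simp add: twisted_conj_def demazure_eq)

abbreviation tc :: "'a \<Rightarrow> 'a \<Rightarrow> 'a" where "tc \<equiv> twisted_conj W S star"
abbreviation tcw :: "'a \<Rightarrow> 'a list \<Rightarrow> 'a" where "tcw \<equiv> twisted_conj_word W S star"
abbreviation invols :: "'a set" where "invols \<equiv> twisted_involutions W star"

lemma tc_closed [simp]: "x \<in> carrier W \<Longrightarrow> w \<in> carrier W \<Longrightarrow> tc x w \<in> carrier W"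
  by (simp add: twisted_conj_eq)

lemma tc_gen: "s \<in> S \<Longrightarrow> tc x s = star s \<odot> x \<odot> s"
  by (simp add: twisted_conj_eq)

lemma star_dprod_gen:
  "s \<in> S \<Longrightarrow> w \<in> carrier W \<Longrightarrow> star (w \<odot> s) = star w \<odot> star s"
  using len_star[of "w \<otimes> s"] by (simp add: rmul_eq star_mult)

text \<open>The source of \<open>tcw_eq_tc_dword\<close>: a word acts only through its Demazure
  product, so identities between Demazure products become identities between chains of
  steps.\<close>

lemma tc_tc_gen:
  assumes "x \<in> carrier W" "y \<in> carrier W" "s \<in> S"
  shows "tc (tc x y) s = tc x (y \<odot> s)"
proof -
  have "inv (star (y \<odot> s)) = star s \<odot> inv (star y)"
    using assms by (simp add: star_dprod_gen inv_dprod_gen)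
  moreover have "inv (star y) \<in> carrier W" "star s \<in> carrier W" using assms by auto
  ultimately show ?thesis
    using assms unfolding tc_gen[OF assms(3)] twisted_conj_eq by (simp add: dprod_assoc)
qed

lemma tcw_Nil [simp]: "tcw x [] = x"
  by (simp add: twisted_conj_word_def)

lemma tcw_Cons [simp]: "tcw x (s # ws) = tcw (tc x s) ws"
  by (simp add: twisted_conj_word_def)

lemma tcw_append [simp]: "tcw x (ws @ ws') = tcw (tcw x ws) ws'"
  by (simp add: twisted_conj_word_def)

lemma tc_one [simp]: "x \<in> carrier W \<Longrightarrow> tc x \<one> = x"
  by (simp add: twisted_conj_eq)

lemma tcw_eq_tc_dword:
  assumes "x \<in> carrier W" "ws \<in> lists S"
  shows "tcw x ws = tc x (dword ws)"
  using assms(2)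
proof (induction ws rule: rev_induct)
  case (snoc s ws)
  then show ?case using assms(1) by (simp add: tc_tc_gen dword_snoc)
qed (use assms in simp)

lemma tcw_closed [simp]: "x \<in> carrier W \<Longrightarrow> ws \<in> lists S \<Longrightarrow> tcw x ws \<in> carrier W"
  by (simp add: tcw_eq_tc_dword)

lemma involI: "\<lbrakk>x \<in> carrier W; star x = inv x\<rbrakk> \<Longrightarrow> x \<in> invols"
  by (simp add: twisted_involutions_def)

lemma inv_invol: "x \<in> invols \<Longrightarrow> inv x = star x"
  by (simp add: twisted_involutions_def)

lemma one_invol [simp]: "\<one> \<in> invols"
  by (simp add: twisted_involutions_def)

lemma invols_closed [simp]: "x \<in> invols \<Longrightarrow> x \<in> carrier W"
  by (simp add: twisted_involutions_def)

lemma len_star_mult: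
  assumes "x \<in> invols" "s \<in> S"
  shows "len (star s \<otimes> x) = len (x \<otimes> s)"
proof -
  have "star s \<otimes> x = star (inv (x \<otimes> s))"
    using assms by (simp add: inv_mult_group star_mult inv_invol star_star)
  then show ?thesis using assms by simp
qed

lemma tc_descent:
  assumes "x \<in> invols" "s \<in> S" "len (x \<otimes> s) < len x"
  shows "tc x s = x"
  using assms len_star_mult[OF assms(1,2)] by (simp add: tc_gen lmul_eq rmul_eq)

text \<open>If the one-sided products coincide, the second multiplication is a descent and is
  absorbed. If they differ, \<open>folding\<close> forces it to lengthen as well, and the step adds
  two to the length.\<close>

lemma tc_ascent:
  assumes "x \<in> invols" "s \<in> S" "len x < len (x \<otimes> s)"
  shows "x \<otimes> s = star s \<otimes> x \<Longrightarrow> tc x s = x \<otimes> s"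
    and "x \<otimes> s \<noteq> star s \<otimes> x \<Longrightarrow> tc x s = star s \<otimes> (x \<otimes> s) \<and> len (tc x s) = len x + 2"
proof -
  note l = len_star_mult[OF assms(1,2)]
  have *: "tc x s = (star s \<otimes> x) \<odot> s" using assms l by (simp add: tc_gen lmul_eq)
  { assume e: "x \<otimes> s = star s \<otimes> x"
    have "tc x s = (x \<otimes> s) \<odot> s" using * unfolding e .
    then show "tc x s = x \<otimes> s" using assms by (simp add: rmul_eq) }
  assume ne: "x \<otimes> s \<noteq> star s \<otimes> x"
  have "len (x \<otimes> s) < len (star s \<otimes> (x \<otimes> s))"
  proof (rule ccontr)
    assume "\<not> ?thesis"
    then show False using ne folding[of "star s" s x] assms l by simp
  qed
  moreover from this have "len (star s \<otimes> (x \<otimes> s)) = len x + 2"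
    using len_gen_mult[of "star s" "x \<otimes> s"] len_mult_gen[of s x] assms by auto
  ultimately show "tc x s = star s \<otimes> (x \<otimes> s) \<and> len (tc x s) = len x + 2"
    using * assms l by (simp add: rmul_eq m_assoc)
qed

lemma tc_invol [simp]:
  assumes "x \<in> invols" "s \<in> S"
  shows "tc x s \<in> invols"
proof (cases "len (x \<otimes> s) < len x")
  case True
  then show ?thesis using tc_descent assms by simp
next
  case False
  then have asc: "len x < len (x \<otimes> s)" using len_mult_gen[of s x] assms by auto
  show ?thesis
  proof (cases "x \<otimes> s = star s \<otimes> x")
    case True
    have "star (x \<otimes> s) = star (star s \<otimes> x)" using True by simp
    also have "\<dots> = s \<otimes> inv x" using assms by (simp add: star_mult star_star inv_invol)
    also have "\<dots> = inv (x \<otimes> s)" using assms by (simp add: inv_mult_group)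
    finally show ?thesis
      using tc_ascent(1)[OF assms asc True] assms by (simp add: involI)
  next
    case False
    have "star (star s \<otimes> (x \<otimes> s)) = s \<otimes> (inv x \<otimes> star s)"
      using assms by (simp add: star_mult star_star inv_invol)
    also have "\<dots> = inv (star s \<otimes> (x \<otimes> s))" using assms by (simp add: inv_mult_group m_assoc)
    finally show ?thesis
      using tc_ascent(2)[OF assms asc False] assms by (simp add: involI)
  qed
qed

lemma tcw_invol [simp]: "x \<in> invols \<Longrightarrow> ws \<in> lists S \<Longrightarrow> tcw x ws \<in> invols"
  by (induction ws arbitrary: x rule: list.induct) auto

lemma len_tc_ascent:
  assumes "x \<in> invols" "s \<in> S" "len x < len (x \<otimes> s)"
  shows "len x < len (tc x s)"
  using tc_ascent[OF assms] assms by (cases "x \<otimes> s = star s \<otimes> x") auto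

lemma tc_gen_descent:
  assumes "x \<in> invols" "s \<in> S"
  shows "len (tc x s \<otimes> s) < len (tc x s)"
proof -
  have "tc x s \<odot> s = tc x s"
  proof -
    have "s \<odot> s = s" using assms(2) by (simp add: lmul_eq gen_mult_self len_gen)
    then show ?thesis using assms by (simp add: tc_gen dprod_assoc)
  qed
  then show ?thesis using assms len_mult_gen[of s "tc x s"]
    by (auto simp: rmul_eq split: if_splits)
qed

text \<open>The unique twisted involution from which \<open>w\<close> is reached by an ascending step \<open>s\<close>.\<close>

definition down :: "'a \<Rightarrow> 'a \<Rightarrow> 'a" where
  "down w s = (if w \<otimes> s = star s \<otimes> w then w \<otimes> s else star s \<otimes> (w \<otimes> s))"

lemma down_tc:
  assumes "x \<in> invols" "s \<in> S" "len x < len (x \<otimes> s)"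
  shows "down (tc x s) s = x"
proof (cases "x \<otimes> s = star s \<otimes> x")
  case True
  have "star s \<otimes> (x \<otimes> s) = x" using True assms by simp
  then show ?thesis using tc_ascent(1)[OF assms True] assms by (simp add: down_def)
next
  case False
  then have "tc x s = star s \<otimes> (x \<otimes> s)" using tc_ascent(2)[OF assms] by simp
  moreover from this have "tc x s \<otimes> s = star s \<otimes> x" "star s \<otimes> tc x s = x \<otimes> s"
    using assms by (simp_all add: m_assoc gen_mult_self)
  ultimately show ?thesis using False assms by (auto simp: down_def)
qed

lemma down:
  assumes "w \<in> invols" "s \<in> S" "len (w \<otimes> s) < len w"
  shows "down w s \<in> invols" "len (down w s) < len (down w s \<otimes> s)" "tc (down w s) s = w"
proof -
  have "down w s \<in> invols \<and> len (down w s) < len (down w s \<otimes> s) \<and> tc (down w s) s = w"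
  proof (cases "w \<otimes> s = star s \<otimes> w")
    case True
    have "star (w \<otimes> s) = star (star s \<otimes> w)" using True by simp
    also have "\<dots> = s \<otimes> inv w" using assms by (simp add: star_mult star_star inv_invol)
    also have "\<dots> = inv (w \<otimes> s)" using assms by (simp add: inv_mult_group)
    finally have I: "w \<otimes> s \<in> invols" using assms by (simp add: involI)
    have asc: "len (w \<otimes> s) < len (w \<otimes> s \<otimes> s)" using assms by simp
    have "star s \<otimes> (w \<otimes> s) = w" using True assms by simp
    then have "tc (w \<otimes> s) s = w" using tc_ascent(1)[OF I assms(2) asc] assms by simp
    then show ?thesis using I asc True by (simp add: down_def)
  next
    case False
    let ?x = "star s \<otimes> (w \<otimes> s)"
    have w: "w \<in> carrier W" "w \<otimes> s \<in> carrier W" using assms by auto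
    have xs: "?x \<otimes> s = star s \<otimes> w" using assms by (simp add: m_assoc gen_mult_self)
    have "star ?x = s \<otimes> (inv w \<otimes> star s)"
      using assms by (simp add: star_mult star_star inv_invol)
    also have "\<dots> = inv ?x" using assms by (simp add: inv_mult_group m_assoc)
    finally have I: "?x \<in> invols" using assms by (simp add: involI)
    \<comment> \<open>Otherwise folding, applied to \<open>w \<otimes> s\<close>, would give
      \<open>?x = w\<close>, which is the case \<open>w \<otimes> s = star s \<otimes> w\<close>
      already treated.\<close>
    have "\<not> len (w \<otimes> s) < len ?x"
    proof
      assume "len (w \<otimes> s) < len ?x"
      then have "?x = w \<otimes> s \<otimes> s"
        using folding[of "star s" s "w \<otimes> s"] assms len_star_mult[OF assms(1,2)] by simp
      then have "star s \<otimes> (star s \<otimes> (w \<otimes> s)) = star s \<otimes> w" using assms by simp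
      then show False using False assms by simp
    qed
    then have asc: "len ?x < len (?x \<otimes> s)"
      using len_gen_mult[of "star s" "w \<otimes> s"] assms len_star_mult[OF assms(1,2)] xs by auto
    have "?x \<otimes> s \<noteq> star s \<otimes> ?x" using False xs assms by auto
    from tc_ascent(2)[OF I assms(2) asc this] have "tc ?x s = w"
      using xs assms by simp
    then show ?thesis using I asc False by (simp add: down_def)
  qed
  then show "down w s \<in> invols" "len (down w s) < len (down w s \<otimes> s)" "tc (down w s) s = w"
    by auto
qed

section \<open>Ascending words\<close>

fun ascending :: "'a \<Rightarrow> 'a list \<Rightarrow> bool" where
  "ascending x [] = True"
| "ascending x (s # ws) \<longleftrightarrow> len x < len (x \<otimes> s) \<and> ascending (tc x s) ws"

lemma ascending_append:
  "ascending x (ws @ ws') \<longleftrightarrow> ascending x ws \<and> ascending (tcw x ws) ws'"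
  by (induction ws arbitrary: x) auto

lemma not_ascending_shorter:
  assumes "x \<in> invols" "ws \<in> lists S" "\<not> ascending x ws"
  shows "\<exists>vs \<in> lists (set ws). length vs < length ws \<and> tcw x vs = tcw x ws"
  using assms
proof (induction ws arbitrary: x rule: list.induct)
  case (Cons s ws)
  have s: "s \<in> S" "ws \<in> lists S" using Cons.prems by auto
  show ?case
  proof (cases "len x < len (x \<otimes> s)")
    case True
    then obtain vs where "vs \<in> lists (set ws)" "length vs < length ws" "tcw (tc x s) vs = tcw (tc x s) ws"
      using Cons.IH[of "tc x s"] Cons.prems s by auto
    then show ?thesis by (intro bexI[of _ "s # vs"]) auto
  next
    case False
    then have "tc x s = x" using tc_descent len_mult_gen[of s x] Cons.prems(1) s by fastforce
    then show ?thesis by (intro bexI[of _ ws]) auto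
  qed
qed simp

lemma ascending_word_exists:
  assumes "w \<in> invols"
  shows "\<exists>ws \<in> lists S. ascending \<one> ws \<and> tcw \<one> ws = w"
  using assms
proof (induction "len w" arbitrary: w rule: less_induct)
  case less
  show ?case
  proof (cases "w = \<one>")
    case False
    obtain x where x: "x \<in> lists S" "length x = len w" "word_prod W x = w"
      using reduced_word less.prems by (metis invols_closed)
    then obtain y s where "x = y @ [s]" using False by (cases x rule: rev_cases) auto
    with x have s: "s \<in> S" "y \<in> lists S" "w = word_prod W y \<otimes> s" "length y < len w"
      by (auto simp: word_prod_append)
    then have "w \<otimes> s = word_prod W y" by simp
    then have desc: "len (w \<otimes> s) < len w" using s len_le[of y] by simp
    note d = down[OF less.prems s(1) desc]
    have "len (down w s) < len w" using len_tc_ascent[OF d(1) s(1) d(2)] d(3) by simp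
    then obtain ws where "ws \<in> lists S" "ascending \<one> ws" "tcw \<one> ws = down w s"
      using less.hyps d(1) by blast
    then show ?thesis using d s by (intro bexI[of _ "ws @ [s]"]) (auto simp: ascending_append)
  qed (auto intro: bexI[of _ "[]"])
qed

end

section \<open>Involution words in dihedral subgroups\<close>

lemma alternating_add:
  "alternating s t (m + n) =
    alternating s t m @ (if even m then alternating s t n else alternating t s n)"
  by (induction m arbitrary: s t) auto

lemma rev_alternating_append_odd:
  "rev (alternating t s k) @ s # alternating t s k =
    (if even k then alternating s t (2 * k + 1) else alternating t s (2 * k + 1))"
  using alternating_add[of s t k "Suc k"] alternating_add[of t s k "Suc k"]
  by (simp add: rev_alternating mult_2)

lemma rev_alternating_append_even:
  "rev (alternating t s k) @ alternating s t k =
    (if even k then alternating s t (2 * k) else alternating t s (2 * k))"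
  using alternating_add[of s t k k] alternating_add[of t s k k]
  by (simp add: rev_alternating mult_2)

section \<open>The automorphism induced by a twisted involution\<close>

context twisted_coxeter_system
begin

definition conj_aut :: "'a \<Rightarrow> 'a \<Rightarrow> 'a" where
  "conj_aut u g = star (u \<otimes> g \<otimes> inv u)"

lemma theta_eq: "theta W S star a = conj_aut (tcw \<one> a)"
  by (intro ext) (simp add: theta_def conj_aut_def Let_def)

lemma conj_aut_closed [simp]: "u \<in> carrier W \<Longrightarrow> g \<in> carrier W \<Longrightarrow> conj_aut u g \<in> carrier W"
  by (simp add: conj_aut_def)

lemma conj_aut_mult:
  "\<lbrakk>u \<in> carrier W; g \<in> carrier W; h \<in> carrier W\<rbrakk> \<Longrightarrow>
    conj_aut u (g \<otimes> h) = conj_aut u g \<otimes> conj_aut u h"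
  using star_mult[of "u \<otimes> g \<otimes> inv u" "u \<otimes> h \<otimes> inv u"] by (simp add: conj_aut_def m_assoc)

lemma conj_aut_gen_iff:
  assumes "u \<in> invols" "r \<in> S" "q \<in> S"
  shows "conj_aut u r = q \<longleftrightarrow> u \<otimes> r = star q \<otimes> u"
proof -
  have "conj_aut u r = q \<longleftrightarrow> u \<otimes> r \<otimes> inv u = star q"
    using assms star_eq_iff[of "u \<otimes> r \<otimes> inv u" "star q"] by (simp add: conj_aut_def star_star)
  also have "\<dots> \<longleftrightarrow> u \<otimes> r = star q \<otimes> u"
    using assms right_cancel[of u "u \<otimes> r \<otimes> inv u" "star q"]
    by (simp add: m_assoc del: right_cancel)
  finally show ?thesis .
qed

text \<open>Inverting the relation and applying \<open>star\<close> exchanges \<open>r\<close> and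
  \<open>q\<close>, as \<open>inv u = star u\<close>. So \<open>\<theta>\<close> is an involution on
  the letters that it keeps inside \<open>S\<close>.\<close>

lemma gen_conj_swap:
  assumes "u \<in> invols" "r \<in> S" "q \<in> S" "u \<otimes> r = star q \<otimes> u"
  shows "u \<otimes> q = star r \<otimes> u"
proof -
  have "r \<otimes> star u = star u \<otimes> star q"
    using arg_cong[OF assms(4), of "\<lambda>x. inv x"] assms(1-3) by (simp add: inv_mult_group inv_invol)
  then have "star (r \<otimes> star u) = star (star u \<otimes> star q)" by simp
  then show ?thesis using assms(1-3) by (simp add: star_mult star_star)
qed

text \<open>Resolves the definite description: the restriction of \<open>conj_aut u\<close> is a
  candidate, and a homomorphism on \<open>W_J\<close> is determined by its values on
  \<open>J\<close>.\<close>

lemma diagram_aut_conj_aut: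
  assumes "J \<subseteq> S" "u \<in> carrier W" "conj_aut u ` J = J" "r \<in> J"
  shows "diagram_aut W J (conj_aut u) r = conj_aut u r"
proof -
  let ?H = "subgroup_generated W J"
  have cH: "carrier ?H = generate W J" using carrier_parabolic[OF assms(1)] .
  have genJ: "generate W J \<subseteq> carrier W" using generate_closed[OF assms(1)] by blast
  define f where "f = restrict (conj_aut u) (generate W J)"
  have hom: "group_hom W W (conj_aut u)"
    using assms(2) by (unfold_locales) (auto simp: hom_def conj_aut_mult)
  have "conj_aut u ` generate W J = generate W J"
    using group_hom.generate_img[OF hom, of J] assms(1,3) gens_subset by auto
  moreover have "inj_on (conj_aut u) (carrier W)"
    using assms(2) by (auto simp: inj_on_def conj_aut_def star_eq_iff)
  ultimately have "bij_betw f (generate W J) (generate W J)"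
    using genJ unfolding bij_betw_def f_def by (auto intro: inj_on_subset)
  moreover have "f \<in> hom ?H ?H"
    using \<open>conj_aut u ` generate W J = generate W J\<close> genJ assms(2) generate_mult
    by (auto simp: hom_def cH f_def conj_aut_mult subset_iff)
  ultimately have iso: "f \<in> iso ?H ?H" by (simp add: iso_def cH)
  have "diagram_aut W J (conj_aut u) = f"
    unfolding diagram_aut_def
  proof (rule the_equality)
    show "f \<in> iso ?H ?H \<and> f \<in> extensional (carrier ?H) \<and> (\<forall>j\<in>J. f j = conj_aut u j)"
      using iso cH by (auto simp: f_def intro: generate.incl)
    fix g assume g: "g \<in> iso ?H ?H \<and> g \<in> extensional (carrier ?H) \<and> (\<forall>j\<in>J. g j = conj_aut u j)"
    then have gm: "g (x \<otimes> y) = g x \<otimes> g y" "g x \<in> carrier W"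
      if "x \<in> generate W J" "y \<in> generate W J" for x y
      using that genJ by (auto simp: iso_def hom_def cH)
    have gw: "g (word_prod W x) = conj_aut u (word_prod W x)" if "x \<in> lists J" for x
      using that
    proof (induction x rule: list.induct)
      case Nil
      have "g \<one> \<otimes> g \<one> = g \<one>" using gm(1)[OF generate.one generate.one] by simp
      then have "g \<one> = \<one>" using gm(2)[of \<one>] generate.one by (metis r_cancel_one)
      then show ?case using assms(2) by (simp add: conj_aut_def)
    next
      case (Cons s x)
      have sx: "s \<in> J" "x \<in> lists J" using Cons.prems by auto
      then have "s \<in> generate W J" "word_prod W x \<in> generate W J"
        by (auto intro: generate.incl word_prod_generate)
      moreover from this have "s \<in> carrier W" "word_prod W x \<in> carrier W" using genJ by auto
      ultimately show ?case using gm(1) Cons.IH sx g assms(2) by (simp add: conj_aut_mult)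
    qed
    show "g = f"
    proof
      fix x show "g x = f x"
      proof (cases "x \<in> generate W J")
        case True
        then obtain l where "l \<in> lists J" "word_prod W l = x"
          using generate_word[OF assms(1)] by metis
        then show ?thesis using gw True by (auto simp: f_def)
      next
        case False
        then show ?thesis using g cH by (auto simp: f_def extensional_def)
      qed
    qed
  qed
  then show ?thesis using assms(4) generate.incl[of r J W] by (simp add: f_def)
qed

text \<open>The closed form of \<open>1 \<ltimes> ws\<close> twisted by \<open>p\<close>: each step
  puts a letter on the right and its image on the left. It uses the product of \<open>W\<close>,
  which allows the comparison with steps from \<open>u\<close>.\<close>

definition delta :: "('a \<Rightarrow> 'a) \<Rightarrow> 'a list \<Rightarrow> 'a" where
  "delta p ws = dword (map p (rev ws) @ ws)"

lemma delta_snoc: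
  assumes "ws \<in> lists J" "r \<in> J" "p ` J = J" "J \<subseteq> S"
  shows "delta p (ws @ [r]) = p r \<odot> delta p ws \<odot> r"
proof -
  have pS: "p j \<in> J" if "j \<in> J" for j using assms(3) that by blast
  then have "map p (rev ws) @ ws \<in> lists S" "p r \<in> S" "r \<in> S"
    using assms by (auto simp: subset_iff)
  then show ?thesis
    using dword_Cons[of "p r" "map p (rev ws) @ ws @ [r]"] dword_snoc[of r "map p (rev ws) @ ws"]
    by (simp add: delta_def dprod_assoc)
qed

lemma delta_generate:
  assumes "ws \<in> lists J" "p ` J = J" "J \<subseteq> S"
  shows "delta p ws \<in> generate W J"
proof -
  have "p j \<in> J" if "j \<in> J" for j using assms(2) that by blast
  then show ?thesis unfolding delta_def using assms by (intro dword_generate) auto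
qed

lemma twisted_conj_word_parabolic:
  assumes J: "J \<subseteq> S" and p: "p ` J = J" and f: "\<And>r. r \<in> J \<Longrightarrow> f r = p r"
    and ws: "ws \<in> lists J"
  shows "twisted_conj_word (subgroup_generated W J) J f \<one> ws = delta p ws"
  using ws
proof (induction ws rule: rev_induct)
  case Nil
  then show ?case by (simp add: twisted_conj_word_def delta_def)
next
  case (snoc r ws)
  let ?H = "subgroup_generated W J"
  have r: "r \<in> J" "ws \<in> lists J" "p r \<in> J" using snoc.prems p by auto
  then have g: "r \<in> generate W J" "p r \<in> generate W J" "delta p ws \<in> generate W J"
    using delta_generate[OF _ p J] by (auto intro: generate.incl)
  have "p r \<odot> delta p ws \<in> generate W J"
    using g r J by (simp add: lmul_eq subset_iff generate_closed generate_mult)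
  moreover have "inv\<^bsub>?H\<^esub> (p r) = p r"
    using g r J carrier_parabolic[OF J] by (simp add: subset_iff)
  ultimately have "twisted_conj ?H J f (delta p ws) r = p r \<odot> delta p ws \<odot> r"
    using g f r by (simp add: twisted_conj_def demazure_parabolic[OF J])
  then show ?case
    using snoc.IH r delta_snoc[OF r(2,1) p J] by (simp add: twisted_conj_word_def)
qed

text \<open>Since \<open>star r \<otimes> u = u \<otimes> conj_aut u r\<close>, the left letter of
  every step passes through \<open>u\<close> into \<open>W_J\<close>; minimality of \<open>u\<close>
  turns \<open>u \<odot> x\<close> into \<open>u \<otimes> x\<close> there.\<close>

lemma tcw_min_rep:
  assumes J: "J \<subseteq> S" and u: "u \<in> invols" and p: "conj_aut u ` J = J"
    and min: "\<And>r. r \<in> J \<Longrightarrow> len u < len (u \<otimes> r)" and ws: "ws \<in> lists J"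
  shows "tcw u ws = u \<otimes> delta (conj_aut u) ws"
  using ws
proof (induction ws rule: rev_induct)
  case Nil
  then show ?case using u by (simp add: delta_def)
next
  case (snoc r ws)
  let ?p = "conj_aut u" let ?z = "delta ?p ws"
  have r: "r \<in> J" "ws \<in> lists J" "?p r \<in> J" "r \<in> S" "?p r \<in> S" using snoc.prems p J by auto
  have z: "?z \<in> generate W J" "?z \<in> carrier W"
    using delta_generate[OF r(2) p J] generate_closed[OF J] by auto
  have mult: "u \<odot> x = u \<otimes> x" if "x \<in> generate W J" for x
    using len_mult_parabolic[OF J _ min that] u generate_closed[OF J that]
    by (intro dprod_reduced) auto
  have e: "u \<otimes> ?p r = star r \<otimes> u"
    using gen_conj_swap[OF u r(4,5)] conj_aut_gen_iff[OF u r(4,5)] by simp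
  have "len u < len (star r \<otimes> u)" using len_star_mult[OF u r(4)] min[OF r(1)] by simp
  then have "star r \<odot> u = u \<odot> ?p r"
    using mult[of "?p r"] r u e by (simp add: lmul_eq generate.incl)
  moreover have "star r \<odot> (u \<otimes> ?z) = star r \<odot> u \<odot> ?z"
    using mult[OF z(1)] r z u by (simp add: dprod_assoc)
  ultimately have su: "star r \<odot> (u \<otimes> ?z) = u \<odot> ?p r \<odot> ?z" by simp
  have "tc (u \<otimes> ?z) r = u \<odot> ?p r \<odot> ?z \<odot> r"
    using su by (simp add: tc_gen r)
  also have "\<dots> = u \<odot> delta ?p (ws @ [r])"
    using delta_snoc[OF r(2,1) p J] r z u by (simp add: dprod_assoc)
  also have "\<dots> = u \<otimes> delta ?p (ws @ [r])"
    using snoc.prems by (intro mult delta_generate[OF _ p J])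
  finally show ?case using snoc.IH r(2) by simp
qed

text \<open>The image of the reversed word and the word join to one alternating word. If
  \<open>p\<close> swaps the letters, its length is \<open>2 * j\<close>; if \<open>p\<close> fixes
  them, the two equal letters in the middle merge, which leaves \<open>2 * j - 1\<close>. For
  \<open>j = 0\<close> truncated subtraction yields \<open>0\<close>, as the empty word
  requires.\<close>

lemma delta_alternating_eq_dih_iff:
  assumes st: "s \<in> S" "t \<in> S" "s \<noteq> t" "cox_m W s t \<noteq> 0" and p: "p ` {s, t} = {s, t}"
  shows "delta p (alternating s t j) = dih s t \<longleftrightarrow>
    (if p s = s then cox_m W s t \<le> 2 * j - 1 else cox_m W s t \<le> 2 * j)"
proof -
  have sym: "dword (alternating t s n) = dih s t \<longleftrightarrow> cox_m W s t \<le> n" for n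
    using dword_alternating_eq_dih_iff[of t s n] st dih_commute[of s t] cox_m_commute[of s t] by auto
  note iff = dword_alternating_eq_dih_iff[OF st] sym
  show ?thesis
  proof (cases "p s = s")
    case True
    then have "p t = t" using p st(3) by auto
    then have 1: "delta p (alternating s t j) = dword (rev (alternating s t j) @ alternating s t j)"
      using True by (simp add: delta_def map_alternating flip: rev_map)
    show ?thesis
    proof (cases j)
      case 0
      then show ?thesis using 1 True iff(1)[of 0] by simp
    next
      case (Suc k)
      let ?l = "alternating t s k"
      have l: "?l \<in> lists S" "rev ?l \<in> lists S" using st by (simp_all add: alternating_in_lists)
      have "s \<odot> s = s" using st(1) by (simp add: lmul_eq gen_mult_self len_gen)
      then have 2: "dword (rev (s # ?l) @ s # ?l) = dword (rev ?l @ s # ?l)"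
        using l st(1) by (simp add: dword_append dword_Cons flip: dprod_assoc)
      have "delta p (alternating s t j) = dword (rev (s # ?l) @ s # ?l)" using 1 Suc by simp
      then have "delta p (alternating s t j) = dih s t \<longleftrightarrow> cox_m W s t \<le> 2 * k + 1"
        using iff[of "2 * k + 1"] unfolding 2 rev_alternating_append_odd
        by (cases "even k") (simp_all del: alternating.simps(2))
      then show ?thesis using Suc True by simp
    qed
  next
    case False
    then have "p s = t" "p t = s" using p st(3) by auto
    then have "delta p (alternating s t j) = dword (rev (alternating t s j) @ alternating s t j)"
      by (simp add: delta_def map_alternating flip: rev_map)
    then show ?thesis using False iff by (simp add: rev_alternating_append_even)
  qed
qed

lemma delta_alternating_commute:
  assumes "s \<in> S" "t \<in> S" "s \<noteq> t" "cox_m W s t \<noteq> 0" "p ` {s, t} = {s, t}"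
  shows "delta p (alternating s t j) = dih s t \<longleftrightarrow> delta p (alternating t s j) = dih s t"
proof -
  have "p s = s \<longleftrightarrow> p t = t" using assms(3,5) by auto
  then show ?thesis
    using delta_alternating_eq_dih_iff[OF assms] delta_alternating_eq_dih_iff[of t s p j] assms
      dih_commute[of s t] cox_m_commute[of s t] by (simp add: insert_commute)
qed

text \<open>\<open>involution_length\<close> applies \<open>the_elem\<close> to a set of lengths, so
  shortest words must be shown to exist and to share their length.\<close>

lemma twisted_m_shortest:
  assumes st: "s \<in> S" "t \<in> S" "s \<noteq> t" "cox_m W s t \<noteq> 0" and a: "a \<in> lists S"
    and p: "theta W S star a ` {s, t} = {s, t}"
  obtains ws where "ws \<in> lists {s, t}" "length ws = twisted_m W S star a s t"
    "delta (theta W S star a) ws = dih s t"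
    "\<And>vs. \<lbrakk>vs \<in> lists {s, t}; delta (theta W S star a) vs = dih s t\<rbrakk> \<Longrightarrow>
      twisted_m W S star a s t \<le> length vs"
proof -
  let ?J = "{s, t}" let ?p = "theta W S star a" let ?H = "subgroup_generated W ?J"
  let ?Q = "\<lambda>ws. ws \<in> lists ?J \<and> delta ?p ws = dih s t"
  let ?IW = "involution_words ?H ?J (diagram_aut W ?J ?p) \<one> (dih s t)"
  have J: "?J \<subseteq> S" using st by simp
  have u: "tcw \<one> a \<in> carrier W" using a by simp
  have "diagram_aut W ?J ?p r = ?p r" if "r \<in> ?J" for r
    using diagram_aut_conj_aut[OF J u] p that by (simp add: theta_eq)
  then have tw: "twisted_conj_word ?H ?J (diagram_aut W ?J ?p) \<one> ws = delta ?p ws"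
    if "ws \<in> lists ?J" for ws
    using twisted_conj_word_parabolic[OF J p] that by blast
  have IW: "?IW = {ws. ?Q ws \<and> (\<forall>vs. ?Q vs \<longrightarrow> length ws \<le> length vs)}"
    unfolding involution_words_def by (rule Collect_cong) (metis tw)
  \<comment> \<open>Merely a witness, in general not a shortest one:
    \<open>m \<le> 2 * m - 1\<close> for \<open>m > 0\<close> covers both kinds of
    \<open>?p\<close>.\<close>
  have "?Q (alternating s t (cox_m W s t))"
    using delta_alternating_eq_dih_iff[OF st p] st(4) by (auto simp: alternating_in_lists)
  from ex_has_least_nat[where P = ?Q, OF this, of length]
  obtain ws where ws: "?Q ws" "\<And>vs. ?Q vs \<Longrightarrow> length ws \<le> length vs" by blast
  have "length vs = length ws" if "vs \<in> ?IW" for vs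
  proof (rule le_antisym)
    have vs: "?Q vs" "\<And>zs. ?Q zs \<Longrightarrow> length vs \<le> length zs" using that unfolding IW by blast+
    show "length vs \<le> length ws" by (rule vs(2)[OF ws(1)])
    show "length ws \<le> length vs" by (rule ws(2)[OF vs(1)])
  qed
  moreover have "ws \<in> ?IW" using ws unfolding IW by blast
  ultimately have "length ` ?IW = {length ws}" by blast
  then have "twisted_m W S star a s t = length ws"
    using p longest_element_dih[OF st] by (simp add: twisted_m_def Let_def involution_length_def)
  then show ?thesis using that[of ws] ws by auto
qed

lemma twisted_m_unstable:
  assumes "s \<in> S" "t \<in> S" "s \<noteq> t" "cox_m W s t \<noteq> 0"
    and "theta W S star a ` {s, t} \<noteq> {s, t}"
  shows "twisted_m W S star a s t = cox_m W s t"
  using assms longest_element_dih[OF assms(1-4)] len_dih[OF assms(1-3)]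
  by (simp add: twisted_m_def Let_def)

lemma twisted_m_commute: "twisted_m W S star a s t = twisted_m W S star a t s"
  by (simp add: twisted_m_def insert_commute)

text \<open>After a step \<open>r\<close> the letter \<open>r\<close> is a descent, so an ascending
  word never has two equal neighbours.\<close>

lemma ascending_alternating:
  assumes "s \<in> S" "t \<in> S" "ws \<in> lists {s, t}" "x \<in> invols" "ascending x ws"
  shows "ws = alternating s t (length ws) \<or> ws = alternating t s (length ws)"
  using assms(3-5)
proof (induction ws arbitrary: x rule: list.induct)
  case (Cons r ws)
  have r: "r \<in> S" "r \<in> {s, t}" "ws \<in> lists {s, t}" using Cons.prems assms by auto
  have IH: "ws = alternating s t (length ws) \<or> ws = alternating t s (length ws)"
    using Cons.IH[of "tc x r"] Cons.prems r by simp
  show ?case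
  proof (cases ws)
    case (Cons q vs)
    then have "len (tc x r) < len (tc x r \<otimes> q)" using Cons.prems(3) by simp
    then have "q \<noteq> r" using tc_gen_descent[OF Cons.prems(2) r(1)] by auto
    then show ?thesis using IH r Cons by auto
  qed (use r in auto)
qed simp

text \<open>Deodhar's description of the double coset of \<open>u\<close>: no cancellation occurs in \<open>z\<^sup>*\<^sup>-\<^sup>1 u b\<close>
  as soon as \<open>z\<close> has no left descent that \<open>u\<close> could move to the other side.\<close>

lemma double_coset_ascent:
  assumes J: "J \<subseteq> S" and u: "u \<in> invols" and min: "\<And>r. r \<in> J \<Longrightarrow> len u < len (u \<otimes> r)"
    and zb: "z \<in> generate W J" "b \<in> generate W J"
    and z: "\<And>r q. \<lbrakk>r \<in> J; q \<in> J; u \<otimes> r = star q \<otimes> u\<rbrakk> \<Longrightarrow> len z < len (q \<otimes> z)"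
    and r: "r \<in> J" "len b < len (b \<otimes> r)"
  shows "len (inv (star z) \<odot> u \<odot> b) < len (inv (star z) \<odot> u \<odot> b \<otimes> r)"
proof -
  let ?I = "star ` J" let ?a = "inv (star z)"
  have I: "?I \<subseteq> S" using J by auto
  have c: "z \<in> carrier W" "b \<in> carrier W" "r \<in> S" "u \<in> carrier W"
    using zb J r u generate_closed by auto
  obtain l where l: "l \<in> lists J" "word_prod W l = inv z"
    using generate_word[OF J generate_inv[OF J zb(1)]] by metis
  have "word_prod W (map star l) = star (word_prod W l)"
    using l(1) J by (induction l rule: list.induct) (auto simp: star_mult subset_iff)
  moreover have "map star l \<in> lists ?I" using l(1) by auto
  ultimately have a: "?a \<in> generate W ?I"
    using word_prod_generate[of "map star l" ?I] l(2) c by (simp add: star_inv)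
  have minI: "len u < len (q \<otimes> u)" if "q \<in> ?I" for q
    using that len_star_mult[OF u] min J by auto
  have "len ?a < len (?a \<otimes> q)" if "r \<in> J" "q \<in> ?I" "u \<otimes> r = q \<otimes> u" for r q
  proof -
    obtain q' where q': "q = star q'" "q' \<in> J" using \<open>q \<in> ?I\<close> by auto
    then have "?a \<otimes> q = star (inv (q' \<otimes> z))"
      using c J by (auto simp: star_inv star_mult inv_mult_group)
    then show ?thesis using z[OF that(1) q'(2)] that(3) q' c J by auto
  qed
  then have au: "len (?a \<otimes> u) < len (?a \<otimes> u \<otimes> r)" if "r \<in> J" for r
    using no_descent_double_coset[OF I J c(4) minI min a] that by blast
  have L: "len (?a \<otimes> u \<otimes> y) = len (?a \<otimes> u) + len y" if "y \<in> generate W J" for y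
    using len_mult_parabolic[OF J _ au that] c by simp
  have "?a \<odot> u = ?a \<otimes> u"
    using len_mult_parabolic_left[OF I c(4) minI a] c by (intro dprod_reduced) auto
  then have "?a \<odot> u \<odot> b = ?a \<otimes> u \<otimes> b"
    using L[OF zb(2)] c dprod_reduced[of "?a \<otimes> u" b] by simp
  moreover have "len (?a \<otimes> u \<otimes> b \<otimes> r) = len (?a \<otimes> u) + len (b \<otimes> r)"
    using L[OF generate_mult[OF zb(2) generate.incl[OF r(1)]]] c by (simp add: m_assoc)
  ultimately show ?thesis using L[OF zb(2)] r(2) by simp
qed

end

section \<open>Braid relations\<close>

context twisted_coxeter_system
begin

lemma tcw_alternating:
  assumes "s \<in> S" "t \<in> S" "s \<noteq> t" "j \<le> cox_m W s t" "x \<in> carrier W"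
  shows "tcw x (alternating s t j) = tc x (word_prod W (alternating s t j))"
  using assms by (simp add: tcw_eq_tc_dword alternating_in_lists dword_alternating_reduced)

text \<open>\<open>\<theta>\<close> can neither swap the letters nor fix both, so at most one letter
  of \<open>J\<close> passes through \<open>u\<close>, and then to itself. The left factor in
  \<open>double_coset_ascent\<close> is chosen so that this letter is not a left descent of
  it.\<close>

lemma unstable_next_ascent:
  assumes st: "s \<in> S" "t \<in> S" "s \<noteq> t" and j: "j < cox_m W s t"
    and u: "u \<in> invols" and min: "\<And>r. r \<in> {s, t} \<Longrightarrow> len u < len (u \<otimes> r)"
    and unst: "conj_aut u ` {s, t} \<noteq> {s, t}"
  shows "len (tcw u (alternating s t j)) <
    len (tcw u (alternating s t j) \<otimes> (if even j then s else t))"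
proof -
  let ?J = "{s, t}" let ?r = "if even j then s else t"
  let ?y = "word_prod W (alternating s t j)"
  have J: "?J \<subseteq> S" using st by simp
  have m: "cox_m W t s = cox_m W s t" using cox_m_commute st by simp
  have alt: "alternating s t n \<in> lists S" "alternating t s n \<in> lists S" for n
    using st by (simp_all add: alternating_in_lists)
  have y: "?y \<in> generate W ?J" "?y \<in> carrier W"
    using alt by (auto intro!: word_prod_generate alternating_in_lists)
  have r: "?r \<in> ?J" "?r \<in> S" using st by auto
  have ly: "len ?y = j" using len_alternating[of s t j] st j by simp
  have "word_prod W (alternating s t (Suc j)) = ?y \<otimes> ?r"
    unfolding alternating_snoc using alt r by (simp add: word_prod_append)
  then have lyr: "len ?y < len (?y \<otimes> ?r)"
    using len_alternating[of s t "Suc j"] st j ly by simp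
  have swap: False if "u \<otimes> s = star t \<otimes> u"
  proof -
    have "u \<otimes> t = star s \<otimes> u" using gen_conj_swap[OF u st(1,2) that] .
    then have "conj_aut u s = t" "conj_aut u t = s"
      using that conj_aut_gen_iff[OF u] st by auto
    then show False using unst by auto
  qed
  have both: False if "u \<otimes> s = star s \<otimes> u" "u \<otimes> t = star t \<otimes> u"
  proof -
    have "conj_aut u s = s" "conj_aut u t = t" using that conj_aut_gen_iff[OF u] st by auto
    then show False using unst by auto
  qed
  show ?thesis
  proof (cases "u \<otimes> s = star s \<otimes> u")
    case False
    have "len ?y < len (q \<otimes> ?y)" if "p \<in> ?J" "q \<in> ?J" "u \<otimes> p = star q \<otimes> u" for p q
    proof -
      \<comment> \<open>Only \<open>t\<close> can pass through \<open>u\<close>, and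
        \<open>?y\<close>, which starts with \<open>s\<close> unless empty, can be prolonged by
        \<open>t\<close> on the left because \<open>j < m(s,t)\<close>.\<close>
      have "q = t" using that False swap gen_conj_swap[OF u, of p q] st by auto
      then show ?thesis using len_alternating[of t s "Suc j"] st j m ly by simp
    qed
    from double_coset_ascent[OF J u min y(1) y(1) this r(1) lyr]
    show ?thesis
      using tcw_alternating[of s t j u] st j u by (simp add: twisted_conj_eq)
  next
    case True
    show ?thesis
    proof (cases j)
      case 0
      then show ?thesis using min by simp
    next
      case (Suc k)
      let ?z = "word_prod W (alternating t s k)"
      have z: "?z \<in> generate W ?J" "?z \<in> carrier W"
        using alt by (auto intro!: word_prod_generate alternating_in_lists)
      have yz: "?y = s \<otimes> ?z" using Suc by simp
      have lz: "len ?z = k" using len_alternating[of t s k] st j m Suc by simp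
      have *: "len ?z < len (q \<otimes> ?z)" if "p \<in> ?J" "q \<in> ?J" "u \<otimes> p = star q \<otimes> u" for p q
      proof -
        have "q = s" using that True both swap gen_conj_swap[OF u, of p q] st by auto
        then show ?thesis using lz ly yz Suc by simp
      qed
      have us: "tc u s = u \<odot> s" "u \<odot> s = u \<otimes> s"
        using tc_ascent(1)[OF u st(1) _ True] min u st by (simp_all add: rmul_eq)
      \<comment> \<open>As \<open>s\<close> passes through \<open>u\<close>, the first step is a
        right multiplication only: the left factor \<open>?z\<close> lacks this letter while the
        right factor \<open>?y\<close> keeps it.\<close>
      have "tcw u (alternating s t j) = tcw (tc u s) (alternating t s k)" using Suc by simp
      also have "\<dots> = tc (u \<odot> s) ?z"
        using tcw_alternating[of t s k "u \<odot> s"] st j m Suc u us by simp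
      also have "\<dots> = inv (star ?z) \<odot> u \<odot> (s \<odot> ?z)"
        using u st z by (simp add: twisted_conj_eq dprod_assoc)
      also have "s \<odot> ?z = ?y" using lz ly yz Suc st z by (simp add: lmul_eq)
      finally show ?thesis
        using double_coset_ascent[OF J u min z(1) y(1) * r(1) lyr] by simp
    qed
  qed
qed

lemma ascending_alternating_unstable:
  assumes st: "s \<in> S" "t \<in> S" "s \<noteq> t" and j: "j \<le> cox_m W s t"
    and u: "u \<in> invols" and min: "\<And>r. r \<in> {s, t} \<Longrightarrow> len u < len (u \<otimes> r)"
    and unst: "conj_aut u ` {s, t} \<noteq> {s, t}"
  shows "ascending u (alternating s t j)"
  using j
proof (induction j)
  case (Suc j)
  then show ?case
    using unstable_next_ascent[OF st _ u min unst, of j]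
    unfolding alternating_snoc ascending_append by simp
qed simp

lemma tcw_dih:
  assumes "s \<in> S" "t \<in> S" "s \<noteq> t" "cox_m W s t \<noteq> 0" "x \<in> carrier W"
  shows "tcw x (alternating s t (cox_m W s t)) = tc x (dih s t)"
  using tcw_alternating[OF assms(1-3) order_refl assms(5)] by (simp add: dih_def)

text \<open>The end point \<open>tc u (dih s t)\<close> is symmetric in \<open>s\<close> and
  \<open>t\<close>, so both alternating words meet there. In the stable case the ascents come from
  the minimality of \<open>twisted_m\<close>: a step that does not ascend could be dropped.\<close>

lemma dihedral_chain:
  assumes st: "s \<in> S" "t \<in> S" "s \<noteq> t" "cox_m W s t \<noteq> 0" and a: "a \<in> lists S"
    and min: "\<And>r. r \<in> {s, t} \<Longrightarrow> len (tcw \<one> a) < len (tcw \<one> a \<otimes> r)"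
  shows "ascending (tcw \<one> a) (alternating s t (twisted_m W S star a s t))"
    and "tcw (tcw \<one> a) (alternating s t (twisted_m W S star a s t)) = tc (tcw \<one> a) (dih s t)"
proof -
  let ?u = "tcw \<one> a" let ?J = "{s, t}" let ?p = "theta W S star a"
  let ?N = "twisted_m W S star a s t" let ?w = "alternating s t ?N"
  have J: "?J \<subseteq> S" using st by simp
  have u: "?u \<in> invols" using a by simp
  have "ascending ?u ?w \<and> tcw ?u ?w = tc ?u (dih s t)"
  proof (cases "?p ` ?J = ?J")
    case False
    then have "?N = cox_m W s t" using twisted_m_unstable[OF st] by simp
    then show ?thesis
      using ascending_alternating_unstable[OF st(1-3) _ u min] False tcw_dih[OF st] u
      by (simp add: theta_eq)
  next
    case True
    have val: "tcw ?u ws = ?u \<otimes> delta ?p ws" if "ws \<in> lists ?J" for ws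
      using tcw_min_rep[OF J u _ min that] True by (simp add: theta_eq)
    have dc: "delta ?p ws \<in> carrier W" if "ws \<in> lists ?J" for ws
      using delta_generate[OF that True J] generate_closed[OF J] by blast
    obtain ws where ws: "ws \<in> lists ?J" "length ws = ?N" "delta ?p ws = dih s t"
      "\<And>vs. \<lbrakk>vs \<in> lists ?J; delta ?p vs = dih s t\<rbrakk> \<Longrightarrow> ?N \<le> length vs"
      using twisted_m_shortest[OF st a True] by metis
    have asc: "ascending ?u vs" if vs: "vs \<in> lists ?J" "length vs = ?N" "delta ?p vs = dih s t" for vs
    proof (rule ccontr)
      assume "\<not> ?thesis"
      moreover have "vs \<in> lists S" using vs(1) J lists_mono by blast
      ultimately obtain vs' where vs': "vs' \<in> lists (set vs)" "length vs' < length vs"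
        "tcw ?u vs' = tcw ?u vs"
        using not_ascending_shorter[OF u] by metis
      have "vs' \<in> lists ?J" using vs(1) vs'(1) by auto
      moreover from this have "delta ?p vs' = dih s t"
        using val[of vs'] val[OF vs(1)] vs vs'(3) dc[of vs'] dc[OF vs(1)] u by simp
      ultimately show False using ws(4)[of vs'] vs(2) vs'(2) by simp
    qed
    \<comment> \<open>The shortest word found may start with either letter;
      \<open>delta_alternating_commute\<close> provides the one that is needed.\<close>
    have "ws = alternating s t ?N \<or> ws = alternating t s ?N"
      using ascending_alternating[OF st(1,2) ws(1) u asc[OF ws(1-3)]] ws(2) by simp
    then have d: "delta ?p ?w = dih s t"
      using ws(3) delta_alternating_commute[OF st True] by auto
    have w: "?w \<in> lists ?J" "alternating s t (cox_m W s t) \<in> lists ?J"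
      by (simp_all add: alternating_in_lists)
    have "delta ?p (alternating s t (cox_m W s t)) = dih s t"
      using delta_alternating_eq_dih_iff[OF st True] st(4) by auto
    then have "tc ?u (dih s t) = ?u \<otimes> dih s t"
      using val[OF w(2)] tcw_dih[OF st, of ?u] u by simp
    then show ?thesis using asc[OF w(1) _ d] val[OF w(1)] d by simp
  qed
  then show "ascending ?u ?w" "tcw ?u ?w = tc ?u (dih s t)" by auto
qed

section \<open>Relating ascending words by braid steps\<close>

lemma braid_rel_sym: "(x, y) \<in> involution_braid_rel W S star \<Longrightarrow> (y, x) \<in> involution_braid_rel W S star"
  using equiv_involution_braid_rel[of star] by (meson equivE symD)

lemma braid_rel_trans: "\<lbrakk>(x, y) \<in> involution_braid_rel W S star; (y, z) \<in> involution_braid_rel W S star\<rbrakk> \<Longrightarrow>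
    (x, z) \<in> involution_braid_rel W S star"
  using equiv_involution_braid_rel[of star] by (meson equivE transD)

text \<open>Appending on the right keeps the prefix that determines \<open>twisted_m\<close>;
  prepending would alter it.\<close>

lemma braid_rel_snoc:
  assumes "(x, y) \<in> involution_braid_rel W S star" "s \<in> S"
  shows "(x @ [s], y @ [s]) \<in> involution_braid_rel W S star"
proof -
  have step: "(x @ [s], y @ [s]) \<in> braid_step W S star" if xy: "(x, y) \<in> braid_step W S star" for x y
  proof -
    obtain a b p q m where *: "x = a @ alternating p q m @ b" "y = a @ alternating q p m @ b"
      "a \<in> lists S" "b \<in> lists S" "p \<in> S" "q \<in> S" "cox_m W p q \<noteq> 0" "m = twisted_m W S star a p q"
      using xy unfolding braid_step_def by blast
    moreover have "b @ [s] \<in> lists S" using * assms(2) by simp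
    ultimately have "(a @ alternating p q m @ (b @ [s]), a @ alternating q p m @ (b @ [s]))
      \<in> braid_step W S star"
      unfolding braid_step_def by blast
    then show ?thesis using * by simp
  qed
  have "(x, y) \<in> (braid_step W S star)\<^sup>*" "x \<in> lists S" "y \<in> lists S"
    using assms(1) by (auto simp: involution_braid_rel_def)
  from this(1) have "(x @ [s], y @ [s]) \<in> (braid_step W S star)\<^sup>*"
    by induction (auto intro: rtrancl.rtrancl_into_rtrancl step)
  then show ?thesis using \<open>x \<in> lists S\<close> \<open>y \<in> lists S\<close> assms(2) by (simp add: involution_braid_rel_def)
qed

text \<open>Both letters fix \<open>w\<close>, so the longest alternating word may be appended to
  \<open>ws\<close> without leaving \<open>w\<close>; in the Demazure product it swallows
  \<open>ws\<close>.\<close>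

lemma double_descent_absorb:
  assumes "s \<in> S" "t \<in> S" "s \<noteq> t" "cox_m W s t \<noteq> 0" "w \<in> invols"
    and desc: "len (w \<otimes> s) < len w" "len (w \<otimes> t) < len w"
    and u: "u \<in> carrier W" "ws \<in> lists {s, t}" "tcw u ws = w"
  shows "tc u (dih s t) = w"
proof -
  have wsS: "ws \<in> lists S" using u(2) assms(1,2) by auto
  have alt: "alternating s t n \<in> lists {s, t}" "alternating s t n \<in> lists S" for n
    using assms(1,2) by (simp_all add: alternating_in_lists)
  have fixed: "tcw w vs = w" if "vs \<in> lists {s, t}" for vs
    using that by (induction vs rule: list.induct) (use tc_descent assms in auto)
  have "w = tcw w (alternating s t (cox_m W s t))" using fixed alt by simp
  also have "\<dots> = tc u (dword (ws @ alternating s t (cox_m W s t)))"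
    using tcw_eq_tc_dword[of u "ws @ alternating s t (cox_m W s t)"] u wsS alt by simp
  also have "dword (ws @ alternating s t (cox_m W s t)) = dih s t"
    using dprod_dih_dword[OF assms(1-4) u(2)] wsS alt assms(1-4)
    by (simp add: dword_append dword_alternating_reduced flip: dih_def)
  finally show ?thesis ..
qed

text \<open>The lengths are carried along because their equality later shows that ascending words
  are shortest.\<close>

lemma ascending_words_braid_related:
  assumes "ws \<in> lists S" "ws' \<in> lists S" "ascending \<one> ws" "ascending \<one> ws'"
    and "tcw \<one> ws = tcw \<one> ws'"
  shows "length ws = length ws' \<and> (ws, ws') \<in> involution_braid_rel W S star"
  using assms
proof (induction "len (tcw \<one> ws)" arbitrary: ws ws' rule: less_induct)
  case less
  let ?R = "involution_braid_rel W S star"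
  let ?w = "tcw \<one> ws"
  have refl: "(x, x) \<in> ?R" if "x \<in> lists S" for x
    using that by (simp add: involution_braid_rel_def)
  have snoc: "p \<in> lists S \<and> s \<in> S \<and> ascending \<one> p \<and> tcw \<one> p = down (tcw \<one> (p @ [s])) s \<and>
      len (tcw \<one> p) < len (tcw \<one> (p @ [s])) \<and>
      len (tcw \<one> (p @ [s]) \<otimes> s) < len (tcw \<one> (p @ [s]))"
    if "p @ [s] \<in> lists S" "ascending \<one> (p @ [s])" for p s
  proof -
    have p: "p \<in> lists S" "s \<in> S" "ascending \<one> p" "len (tcw \<one> p) < len (tcw \<one> p \<otimes> s)"
      using that by (auto simp: ascending_append)
    then have "tcw \<one> p \<in> invols" by simp
    then show ?thesis
      using p down_tc[of "tcw \<one> p" s] len_tc_ascent[of "tcw \<one> p" s] tc_gen_descent[of "tcw \<one> p" s]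
      by simp
  qed
  have pos: "0 < len (tcw \<one> (p @ [s]))" if "p @ [s] \<in> lists S" "ascending \<one> (p @ [s])" for p s
    using snoc[OF that] by linarith
  consider "ws = []" "ws' = []" | p s where "ws = p @ [s]" "ws' = []" | p s where "ws = []" "ws' = p @ [s]"
    | p s p' s' where "ws = p @ [s]" "ws' = p' @ [s']"
    by (metis rev_exhaust)
  then show ?case
  proof cases
    case 1
    then show ?thesis using refl by simp
  next
    case 2
    then have "0 < len ?w" using pos[of p s] less.prems by simp
    then show ?thesis using less.prems(5) 2 by simp
  next
    case 3
    then have "0 < len (tcw \<one> ws')" using pos[of p s] less.prems by simp
    then show ?thesis using less.prems(5) 3 by simp
  next
    case (4 p s p' t)
    have p: "p \<in> lists S" "s \<in> S" "ascending \<one> p" "tcw \<one> p = down ?w s"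
      "len (tcw \<one> p) < len ?w" "len (?w \<otimes> s) < len ?w"
      using snoc[of p s] less.prems(1,3) unfolding 4 by blast+
    have p': "p' \<in> lists S" "t \<in> S" "ascending \<one> p'" "tcw \<one> p' = down ?w t"
      "len (tcw \<one> p') < len ?w" "len (?w \<otimes> t) < len ?w"
      using snoc[of p' t] less.prems(2,4) unfolding less.prems(5) 4(2) by blast+
    have w: "?w \<in> invols" using less.prems by simp
    \<comment> \<open>Ascending words for \<open>?w\<close> with the same last letter
      \<open>r\<close> have prefixes for the same shorter element \<open>down ?w r\<close>, to which
      the induction hypothesis applies.\<close>
    have related: "length (q @ [r]) = length (c @ [r]) \<and> (q @ [r], c @ [r]) \<in> ?R"
      if q: "q \<in> lists S" "ascending \<one> q" "tcw \<one> q = down ?w r" "len (tcw \<one> q) < len ?w"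
        and c: "c @ [r] \<in> lists S" "ascending \<one> (c @ [r])" "tcw \<one> (c @ [r]) = ?w" for q c r
    proof -
      have "c \<in> lists S" "r \<in> S" "ascending \<one> c" "tcw \<one> c = down ?w r"
        using snoc[OF c(1,2)] c(3) by auto
      then have "length q = length c \<and> (q, c) \<in> ?R" using less.hyps[of q c] q by simp
      then show ?thesis using braid_rel_snoc \<open>r \<in> S\<close> by simp
    qed
    show ?thesis
    proof (cases "s = t")
      case True
      then have "p' @ [s] \<in> lists S" "ascending \<one> (p' @ [s])" "tcw \<one> (p' @ [s]) = ?w"
        using less.prems(2,4,5) 4(2) by simp_all
      from related[OF p(1,3,4,5) this] show ?thesis using True 4 by blast
    next
      case False
      let ?J = "{s, t}"
      have fin: "cox_m W s t \<noteq> 0"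
        using both_descents_finite[OF p(2) p'(2) False _ p(6) p'(6)] w by simp
      \<comment> \<open>The twisted involutions that lead to \<open>?w\<close> by letters of
        \<open>J\<close>. A shortest one has no descent in \<open>J\<close>, since
        \<open>down\<close> stays in this set.\<close>
      define C where "C = (\<lambda>x. x \<in> invols \<and> (\<exists>vs \<in> lists ?J. tcw x vs = ?w))"
      have "C ?w" unfolding C_def using w by (intro conjI bexI[of _ "[]"]) auto
      from ex_has_least_nat[where P = C, OF this, of len]
      obtain u where u: "C u" "\<And>x. C x \<Longrightarrow> len u \<le> len x" by auto
      then obtain vs where vs: "u \<in> invols" "vs \<in> lists ?J" "tcw u vs = ?w" by (auto simp: C_def)
      have min: "len u < len (u \<otimes> r)" if r: "r \<in> ?J" for r
      proof (rule ccontr)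
        assume "\<not> ?thesis"
        moreover have rS: "r \<in> S" using r p p' by auto
        ultimately have desc: "len (u \<otimes> r) < len u" using len_mult_gen[of r u] vs(1) by auto
        note d = down[OF vs(1) rS desc]
        have "C (down u r)"
          unfolding C_def using d vs r by (intro conjI bexI[of _ "r # vs"]) auto
        then show False using u(2) len_tc_ascent[OF d(1) rS d(2)] d(3) by fastforce
      qed
      \<comment> \<open>A concrete prefix is chosen because braid steps and \<open>twisted_m\<close>
        refer to words, not to elements.\<close>
      obtain c where c: "c \<in> lists S" "ascending \<one> c" "tcw \<one> c = u"
        using ascending_word_exists[OF vs(1)] by blast
      define N where "N = twisted_m W S star c s t"
      have top: "tc u (dih s t) = ?w"
        using double_descent_absorb[OF p(2) p'(2) False fin w p(6) p'(6) _ vs(2,3)] vs(1) by simp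
      have chain: "ascending u (alternating s t N)" "tcw u (alternating s t N) = ?w"
        using dihedral_chain[OF p(2) p'(2) False fin c(1)] min top c(3) N_def by auto
      have chain': "ascending u (alternating t s N)" "tcw u (alternating t s N) = ?w"
        using dihedral_chain[OF p'(2) p(2) _ _ c(1)] min top c(3) N_def False fin
          cox_m_commute[OF p(2) p'(2)] dih_commute[OF p(2) p'(2)] twisted_m_commute[of c s t] by auto
      have "N \<noteq> 0"
      proof
        assume "N = 0"
        then have "u = ?w" using chain by simp
        then show False using min[of s] p(6) by simp
      qed
      then obtain k where N: "N = Suc k" using not0_implies_Suc by blast
      \<comment> \<open>The parity of \<open>k\<close> selects the first letters so that the two
        alternating words end in \<open>s\<close> and \<open>t\<close>, like \<open>ws\<close> and
        \<open>ws'\<close>.\<close>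
      define x where "x = (if even k then s else t)"
      define y where "y = (if even k then t else s)"
      have A: "alternating x y N = alternating x y k @ [s]" "alternating y x N = alternating y x k @ [t]"
        unfolding N alternating_snoc x_def y_def by auto
      have xy: "x \<in> S" "y \<in> S" "cox_m W x y \<noteq> 0" "N = twisted_m W S star c x y"
        using p(2) p'(2) fin cox_m_commute[OF p(2) p'(2)] twisted_m_commute[of c s t] N_def
        by (auto simp: x_def y_def)
      have asc: "ascending \<one> (c @ alternating x y N)" "ascending \<one> (c @ alternating y x N)"
        "tcw \<one> (c @ alternating x y N) = ?w" "tcw \<one> (c @ alternating y x N) = ?w"
        using chain chain' c by (auto simp: ascending_append x_def y_def)
      have alt: "alternating x y n \<in> lists S" "alternating y x n \<in> lists S" for n
        using xy by (simp_all add: alternating_in_lists)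
      have "(c @ alternating x y N @ [], c @ alternating y x N @ []) \<in> braid_step W S star"
        unfolding braid_step_def using xy c(1) by blast
      then have mid: "(c @ alternating x y N, c @ alternating y x N) \<in> ?R"
        unfolding involution_braid_rel_def using c(1) alt by auto
      have cA: "c @ alternating x y N = (c @ alternating x y k) @ [s]"
        "c @ alternating y x N = (c @ alternating y x k) @ [t]"
        using A by simp_all
      have cS: "c @ alternating x y N \<in> lists S" "c @ alternating y x N \<in> lists S"
        using c(1) alt by simp_all
      have 1: "length ws = length (c @ alternating x y N) \<and> (ws, c @ alternating x y N) \<in> ?R"
        using related[OF p(1,3,4,5), of "c @ alternating x y k", folded cA 4(1), OF cS(1) asc(1,3)] .
      have 2: "length ws' = length (c @ alternating y x N) \<and> (ws', c @ alternating y x N) \<in> ?R"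
        using related[OF p'(1,3,4,5), of "c @ alternating y x k", folded cA 4(2), OF cS(2) asc(2,4)] .
      have "(ws, ws') \<in> ?R"
        by (rule braid_rel_trans[OF braid_rel_trans[OF conjunct2[OF 1] mid]
              braid_rel_sym[OF conjunct2[OF 2]]])
      then show ?thesis using 1 2 by simp
    qed
  qed
qed

text \<open>For the inclusion from right to left, any word for \<open>w\<close> shrinks to an
  ascending one by dropping idle letters, and all ascending words for \<open>w\<close> have equal
  length.\<close>

lemma involution_words_iff:
  "involution_words W S star \<one> w = {ws \<in> lists S. ascending \<one> ws \<and> tcw \<one> ws = w}"
proof (intro equalityI subsetI)
  fix ws assume "ws \<in> involution_words W S star \<one> w"
  then have ws: "ws \<in> lists S" "tcw \<one> ws = w" "\<And>vs. \<lbrakk>vs \<in> lists S; tcw \<one> vs = w\<rbrakk> \<Longrightarrow> length ws \<le> length vs"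
    by (auto simp: involution_words_def)
  have "ascending \<one> ws"
  proof (rule ccontr)
    assume "\<not> ?thesis"
    then obtain vs where vs: "vs \<in> lists (set ws)" "length vs < length ws" "tcw \<one> vs = tcw \<one> ws"
      using not_ascending_shorter[OF one_invol ws(1)] by blast
    then have "vs \<in> lists S" using ws(1) by auto
    then show False using ws vs by fastforce
  qed
  then show "ws \<in> {ws \<in> lists S. ascending \<one> ws \<and> tcw \<one> ws = w}" using ws by simp
next
  fix ws assume "ws \<in> {ws \<in> lists S. ascending \<one> ws \<and> tcw \<one> ws = w}"
  then have ws: "ws \<in> lists S" "ascending \<one> ws" "tcw \<one> ws = w" by auto
  have "length ws \<le> length vs" if "vs \<in> lists S" "tcw \<one> vs = w" for vs
    using that
  proof (induction "length vs" arbitrary: vs rule: less_induct)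
    case less
    show ?case
    proof (cases "ascending \<one> vs")
      case True
      then show ?thesis using ascending_words_braid_related[OF ws(1) less.prems(1) ws(2)] ws less.prems
        by simp
    next
      case False
      then obtain vs' where vs': "vs' \<in> lists (set vs)" "length vs' < length vs" "tcw \<one> vs' = tcw \<one> vs"
        using not_ascending_shorter[OF one_invol less.prems(1)] by blast
      then have "vs' \<in> lists S" using less.prems(1) by auto
      then show ?thesis using less.hyps[of vs'] vs' less.prems by simp
    qed
  qed
  then show "ws \<in> involution_words W S star \<one> w" using ws by (auto simp: involution_words_def)
qed

text \<open>A step keeps the length, so it suffices that both segments lead from \<open>?u\<close>
  to the same element. Since \<open>t\<close> is not known to be an ascent of \<open>?u\<close>,
  \<open>dihedral_chain\<close> does not cover every case.\<close>

lemma involution_words_braid_step: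
  assumes "ws \<in> involution_words W S star \<one> w" "(ws, ws') \<in> braid_step W S star"
  shows "ws' \<in> involution_words W S star \<one> w"
proof -
  obtain a b s t m where ws: "ws = a @ alternating s t m @ b" "ws' = a @ alternating t s m @ b"
    and S: "a \<in> lists S" "b \<in> lists S" "s \<in> S" "t \<in> S" "cox_m W s t \<noteq> 0"
    and m: "m = twisted_m W S star a s t"
    using assms(2) unfolding braid_step_def by blast
  let ?u = "tcw \<one> a" let ?p = "theta W S star a"
  have u: "?u \<in> invols" using S by simp
  have asc: "ascending ?u (alternating s t m)"
    using assms(1) unfolding involution_words_iff ws by (simp add: ascending_append)
  have "tcw ?u (alternating s t m) = tcw ?u (alternating t s m)"
  proof (cases "s = t \<or> m = 0")
    case False
    then have st: "s \<noteq> t" "m \<noteq> 0" by auto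
    note st4 = S(3,4) st(1) S(5)
    have comm: "cox_m W t s = cox_m W s t" "dih t s = dih s t"
      using cox_m_commute dih_commute S by auto
    obtain k where k: "m = Suc k" using st(2) not0_implies_Suc by blast
    have s_asc: "len ?u < len (?u \<otimes> s)" using asc k by simp
    show ?thesis
    proof (cases "?p ` {s, t} = {s, t}")
      case False
      \<comment> \<open>With \<open>m = m(s,t)\<close> both segments act as the longest element,
        from any starting element.\<close>
      then have "m = cox_m W s t" using m twisted_m_unstable[OF st4] by simp
      then show ?thesis using tcw_dih[of s t ?u] tcw_dih[of t s ?u] st4 comm u by simp
    next
      case True
      show ?thesis
      proof (cases "len ?u < len (?u \<otimes> t)")
        case t_asc: True
        have min: "len ?u < len (?u \<otimes> r)" if "r \<in> {s, t}" for r
          using that s_asc t_asc by auto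
        have "tcw ?u (alternating s t m) = tc ?u (dih s t)"
          using dihedral_chain(2)[OF st4 S(1) min] m by simp
        moreover have "tcw ?u (alternating t s m) = tc ?u (dih t s)"
          using dihedral_chain(2)[OF S(4,3) st(1)[symmetric] _ S(1) min] m S(5) comm(1)
            twisted_m_commute[of a s t] by (simp add: insert_commute)
        ultimately show ?thesis using comm(2) by simp
      next
        case False
        \<comment> \<open>This case is void. A descent \<open>t\<close> next to the ascent
          \<open>s\<close> makes \<open>\<theta>\<close> fix both letters, and \<open>t\<close>
          stays a descent after the step \<open>s\<close>. The ascending segment then has a single
          letter, so the longest element has length one, against
          \<open>s \<noteq> t\<close>.\<close>
        then have t_desc: "len (?u \<otimes> t) < len ?u" using len_mult_gen[of t ?u] S u by auto
        have "?p s \<noteq> t"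
        proof
          assume "?p s = t"
          then have "?u \<otimes> s = star t \<otimes> ?u"
            using conj_aut_gen_iff[OF u S(3,4)] by (simp add: theta_eq)
          then show False using len_star_mult[OF u S(4)] s_asc t_desc by simp
        qed
        then have p: "?p s = s" "?p t = t" using True st(1) by auto
        have us: "?u \<otimes> s = star s \<otimes> ?u"
          using p conj_aut_gen_iff[OF u S(3,3)] by (simp add: theta_eq)
        have "tc ?u s = ?u \<otimes> s" by (rule tc_ascent(1)[OF u S(3) s_asc us])
        moreover have "len (?u \<otimes> s \<otimes> t) < len (?u \<otimes> s)"
        proof -
          have "?u \<otimes> s \<otimes> t = star s \<otimes> (?u \<otimes> t)" unfolding us using S u by (simp add: m_assoc)
          then have "len (?u \<otimes> s \<otimes> t) \<le> len (?u \<otimes> t) + 1"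
            using len_gen_mult[of "star s" "?u \<otimes> t"] S u by auto
          then show ?thesis using t_desc s_asc by simp
        qed
        ultimately have "k = 0" using asc k by (cases k) auto
        then have "m = 1" using k by simp
        obtain vs where vs: "vs \<in> lists {s, t}" "length vs = m" "delta ?p vs = dih s t"
          using twisted_m_shortest[OF st4 S(1) True] m by metis
        obtain r where r': "vs = [r]" using vs(2) \<open>m = 1\<close> by (auto simp: length_Suc_conv)
        have r: "r \<in> {s, t}" "delta ?p [r] = dih s t"
          using vs(1,3) unfolding r' by simp_all
        have "dih s t = r"
        proof -
          have "r \<in> S" "?p r = r" using r(1) p S(3,4) by auto
          moreover from this have "r \<odot> r = r" by (simp add: lmul_eq len_gen gen_mult_self)
          ultimately show ?thesis using r(2) by (simp add: delta_def dword_Cons)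
        qed
        then have "cox_m W s t = 1" using len_dih[OF st4(1-3)] r S len_gen by auto
        then have "s = t" using comm(2) S by (simp add: dih_def comm(1))
        then show ?thesis using st by simp
      qed
    qed
  qed auto
  then have "tcw \<one> ws' = tcw \<one> ws" "length ws' = length ws" by (simp_all add: ws)
  moreover have "ws' \<in> lists S" using S by (simp add: ws alternating_in_lists)
  ultimately show ?thesis using assms(1) by (simp add: involution_words_def)
qed

lemma involution_words_class:
  assumes "w \<in> invols"
  shows "involution_words W S star \<one> w \<in> lists S // involution_braid_rel W S star"
proof -
  obtain ws where ws: "ws \<in> lists S" "ascending \<one> ws" "tcw \<one> ws = w"
    using ascending_word_exists[OF assms] by blast
  have "involution_words W S star \<one> w = involution_braid_rel W S star `` {ws}"
  proof (intro equalityI subsetI)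
    fix vs assume "vs \<in> involution_words W S star \<one> w"
    then show "vs \<in> involution_braid_rel W S star `` {ws}"
      using ascending_words_braid_related[of ws vs] ws by (auto simp: involution_words_iff)
  next
    fix vs assume "vs \<in> involution_braid_rel W S star `` {ws}"
    then have "(ws, vs) \<in> (braid_step W S star)\<^sup>*" by (simp add: involution_braid_rel_def)
    then show "vs \<in> involution_words W S star \<one> w"
    proof induction
      case base
      show ?case using ws by (simp add: involution_words_iff)
    next
      case step
      then show ?case using involution_words_braid_step by blast
    qed
  qed
  then show ?thesis using ws(1) by (simp add: quotientI)
qed

end

theorem theorem7p9:
  fixes W :: "('a, 'b) monoid_scheme" and S :: "'a set" and star :: "'a \<Rightarrow> 'a" and w :: 'a
  assumes "twisted_coxeter_system W S star"
    and "w \<in> twisted_involutions W star"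
  shows "involution_words W S star \<one>\<^bsub>W\<^esub> w \<in> lists S // involution_braid_rel W S star"
  using twisted_coxeter_system.involution_words_class[OF assms] .

end
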